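(* Let $|\lambda|<1$ and let $\varphi$ be measurable on $\mathbb{T}$. Then the $\lambda$-Toeplitz operator $T_{\lambda,\varphi}$ is bounded if and only if $\varphi\in L^2$. In fact, every bounded $\lambda$-Toeplitz operator is Hilbert-Schmidt if $|\lambda|<1$, and we have $$\|T_{\lambda,\varphi}\|\le(1-|\lambda|^2)^{-1/2}\Big(\sum_{n=-\infty}^\infty|a_n|^2\Big)^{1/2},$$ where $\varphi\sim\sum a_ne^{in\theta}$.
   Context: $\lambda$ is a complex number, $\mathbb{T}$ is the unit circle, and $L^2=L^2(\mathbb{T})$ is the Hilbert space of square integrable functions on $\mathbb{T}$ with inner product $\langle f,g\rangle=\frac{1}{2\pi}\int_0^{2\pi} f\overline{g}\,d\theta$. The notation $\varphi\sim\sum a_n e^{in\theta}$ means that $\sum_{n=-\infty}^\infty a_ne^{in\theta}$ is the Fourier series of $\varphi$. The Hardy space $H^2\subseteq L^2$ is the closed subspace of functions whose Fourier coefficients of negative index vanish, with orthonormal basis $e_n=e^{in\theta}$, $n=0,1,2,\dots$. For $|\lambda|\le1$, a bounded operator $T$ on $H^2$ is called a $\lambda$-Toeplitz operator if $\langle Te_{m+1},e_{n+1}\rangle=\lambda\langle Te_m,e_n\rangle$ for all $m,n\ge0$. For $\varphi\sim\sum a_ne^{in\theta}$, $T_{\lambda,\varphi}$ denotes the operator on $H^2$ given by the matrix $$\langle T_{\lambda,\varphi}e_j,e_i\rangle=\lambda^{\min(i,j)}a_{i-j},\qquad i,j\ge 0,$$ with respect to $(e_n)_{n\ge0}$, where $\lambda^0=1$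 (also for $\lambda=0$); it is called bounded if this matrix is the matrix of a bounded operator on $H^2$. *)

theory Defs
  imports "HOL-Analysis.Analysis"
begin

text \<open>
  A function on the unit circle is represented by a function \<open>f :: complex \<Rightarrow> complex\<close> of which
  only the values \<open>f (cis t)\<close>, \<open>0 \<le> t \<le> 2 * pi\<close>, matter. Elements of \<open>L\<^sup>2\<close> and \<open>H\<^sup>2\<close> are
  represented by functions rather than by classes modulo null sets, so equality of elements is
  \<open>circle_eq\<close>.
\<close>

abbreviation arc :: "real measure" where
  "arc \<equiv> lebesgue_on {0..2 * pi}"

definition circle_measurable :: "(complex \<Rightarrow> complex) \<Rightarrow> bool" where
  "circle_measurable f \<longleftrightarrow> (\<lambda>t. f (cis t)) \<in> borel_measurable arc"

definition circle_integrable :: "(complex \<Rightarrow> complex) \<Rightarrow> bool" where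
  "circle_integrable f \<longleftrightarrow> integrable arc (\<lambda>t. f (cis t))"

definition circle_eq :: "(complex \<Rightarrow> complex) \<Rightarrow> (complex \<Rightarrow> complex) \<Rightarrow> bool" where
  "circle_eq f g \<longleftrightarrow> (AE t in arc. f (cis t) = g (cis t))"

definition L2 :: "(complex \<Rightarrow> complex) set" where
  "L2 = {f. circle_measurable f \<and> integrable arc (\<lambda>t. (norm (f (cis t)))\<^sup>2)}"

definition circle_inner :: "(complex \<Rightarrow> complex) \<Rightarrow> (complex \<Rightarrow> complex) \<Rightarrow> complex" where
  "circle_inner f g = 1 / (2 * pi) * (LINT t|arc. f (cis t) * cnj (g (cis t)))"

definition L2_norm :: "(complex \<Rightarrow> complex) \<Rightarrow> real" where
  "L2_norm f = sqrt (Re (circle_inner f f))"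

text \<open>The \<open>n\<close>-th Fourier coefficient; meaningful whenever \<open>circle_integrable f\<close>.\<close>

definition fourier_coeff :: "(complex \<Rightarrow> complex) \<Rightarrow> int \<Rightarrow> complex" where
  "fourier_coeff f n = circle_inner f (\<lambda>z. z powi n)"

definition H2 :: "(complex \<Rightarrow> complex) set" where
  "H2 = {f \<in> L2. \<forall>n<0. fourier_coeff f n = 0}"

definition hardy_basis :: "nat \<Rightarrow> complex \<Rightarrow> complex" where
  "hardy_basis n = (\<lambda>z. z ^ n)"

text \<open>
  Linearity is required modulo null sets. Together with the norm bound it makes \<open>T\<close> respect
  \<open>circle_eq\<close> on \<open>H2\<close>, so these are exactly the representatives of the bounded operators on
  the Hilbert space of classes.
\<close>

definition bounded_operator :: "((complex \<Rightarrow> complex) \<Rightarrow> complex \<Rightarrow> complex) \<Rightarrow> bool" where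
  "bounded_operator T \<longleftrightarrow>
     (\<forall>f\<in>H2. T f \<in> H2) \<and>
     (\<forall>f\<in>H2. \<forall>g\<in>H2. circle_eq (T (\<lambda>z. f z + g z)) (\<lambda>z. T f z + T g z)) \<and>
     (\<forall>c. \<forall>f\<in>H2. circle_eq (T (\<lambda>z. c * f z)) (\<lambda>z. c * T f z)) \<and>
     (\<exists>C. \<forall>f\<in>H2. L2_norm (T f) \<le> C * L2_norm f)"

definition operator_norm :: "((complex \<Rightarrow> complex) \<Rightarrow> complex \<Rightarrow> complex) \<Rightarrow> real" where
  "operator_norm T = (SUP f\<in>{f \<in> H2. L2_norm f \<le> 1}. L2_norm (T f))"

text \<open>An orthonormal basis is a total orthonormal system; \<open>H\<^sup>2\<close> is separable and infinite-dimensional,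
  so its orthonormal bases are sequences.\<close>

definition orthonormal_basis :: "(nat \<Rightarrow> complex \<Rightarrow> complex) \<Rightarrow> bool" where
  "orthonormal_basis b \<longleftrightarrow>
     (\<forall>n. b n \<in> H2) \<and>
     (\<forall>m n. circle_inner (b m) (b n) = (if m = n then 1 else 0)) \<and>
     (\<forall>f\<in>H2. (\<forall>n. circle_inner f (b n) = 0) \<longrightarrow> circle_eq f (\<lambda>z. 0))"

definition hilbert_schmidt :: "((complex \<Rightarrow> complex) \<Rightarrow> complex \<Rightarrow> complex) \<Rightarrow> bool" where
  "hilbert_schmidt T \<longleftrightarrow> bounded_operator T \<and>
     (\<exists>b. orthonormal_basis b \<and> summable (\<lambda>n. (L2_norm (T (b n)))\<^sup>2))"

definition lambda_toeplitz :: "complex \<Rightarrow> ((complex \<Rightarrow> complex) \<Rightarrow> complex \<Rightarrow> complex) \<Rightarrow> bool" where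
  "lambda_toeplitz l T \<longleftrightarrow> bounded_operator T \<and>
     (\<forall>m n. circle_inner (T (hardy_basis (Suc m))) (hardy_basis (Suc n)) =
       l * circle_inner (T (hardy_basis m)) (hardy_basis n))"

text \<open>
  \<open>represents l \<phi> T\<close>: the function \<open>\<phi>\<close> has a Fourier series, and \<open>T\<close> is a bounded operator on
  \<open>H\<^sup>2\<close> with the matrix of \<open>T\<^bsub>l,\<phi>\<^esub>\<close>. Without the integrability clause the totalised integral would
  assign the zero matrix to every non-integrable \<open>\<phi>\<close>.
\<close>

definition represents :: "complex \<Rightarrow> (complex \<Rightarrow> complex) \<Rightarrow>
    ((complex \<Rightarrow> complex) \<Rightarrow> complex \<Rightarrow> complex) \<Rightarrow> bool" where
  "represents l \<phi> T \<longleftrightarrow> circle_integrable \<phi> \<and> bounded_operator T \<and>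
     (\<forall>i j. circle_inner (T (hardy_basis j)) (hardy_basis i) = l ^ min i j * fourier_coeff \<phi> (int i - int j))"

definition toeplitz_bounded :: "complex \<Rightarrow> (complex \<Rightarrow> complex) \<Rightarrow> bool" where
  "toeplitz_bounded l \<phi> \<longleftrightarrow> (\<exists>T. represents l \<phi> T)"

end

theory Submission imports Defs
begin

text \<open>
  Grouped by diagonals, the matrix of \<open>T\<^bsub>l,\<phi>\<^esub>\<close> contains the entry \<open>l\<^sup>k a\<^sub>n\<close> exactly once for
  every \<open>k \<ge> 0\<close> and \<open>n \<in> \<int>\<close>, so its squared Hilbert-Schmidt norm is
  \<open>(1 - \<bar>l\<bar>\<^sup>2)\<^sup>-\<^sup>1 \<Sum>\<^sub>n \<bar>a\<^sub>n\<bar>\<^sup>2\<close>, and it bounds the operator norm. Conversely the first column and the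
  first row of a bounded matrix are square summable, which gives \<open>\<Sum>\<^sub>n \<bar>a\<^sub>n\<bar>\<^sup>2 < \<infinity>\<close>. An integrable
  \<open>\<phi>\<close> with such coefficients lies in \<open>L\<^sup>2\<close>: by Riesz-Fischer some \<open>g\<close> in \<open>L\<^sup>2\<close> has the same
  coefficients, and the Fourier coefficients of an integrable function determine it almost everywhere.
\<close>

subsection \<open>The inner product on the circle\<close>

text \<open>The same uniqueness gives more: it identifies an L^2 function with the Riesz-Fischer
  limit of its own series, hence Parseval and totality of the basis, and it turns equality of
  coefficients into \<open>circle_eq\<close>, the only sense in which a constructed operator is
  linear.

  The first column of the matrix is the image of a vector, so Parseval applies to it. The first row
  belongs to the adjoint, which is never constructed; testing the operator on finite combinations of
  basis vectors replaces it.

  A \<lambda>-Toeplitz operator comes without a symbol, so for the Hilbert-Schmidt claim the numbers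
  \<open>a n\<close> are taken from the border of the matrix. There the power of \<lambda> is the
  zeroth, so nothing is divided by \<lambda> and the case \<lambda> = 0 is included.\<close>

lemma arc_finite_measure: "finite_measure arc"
  by (rule finite_measure_lebesgue_on) auto

lemma measurable_arc_continuous:
  assumes "continuous_on UNIV f"
  shows "f \<in> borel_measurable arc"
  using assms by (intro continuous_imp_measurable_on_sets_lebesgue) (auto intro: continuous_on_subset)

lemma integrable_arc_bounded:
  fixes f :: "real \<Rightarrow> 'a::{banach, second_countable_topology}"
  assumes "f \<in> borel_measurable arc" "\<And>t. norm (f t) \<le> B"
  shows "integrable arc f"
  using assms by (intro finite_measure.integrable_const_bound[OF arc_finite_measure]) auto

lemma borel_measurable_cnj [measurable (raw)]:
  fixes f :: "'a \<Rightarrow> complex"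
  assumes "f \<in> borel_measurable M"
  shows "(\<lambda>x. cnj (f x)) \<in> borel_measurable M"
  by (rule borel_measurable_continuous_on[OF _ assms]) (intro continuous_intros)

lemma L2_iff: "f \<in> L2 \<longleftrightarrow> (\<lambda>t. f (cis t)) \<in> borel_measurable arc \<and> integrable arc (\<lambda>t. (norm (f (cis t)))\<^sup>2)"
  by (simp add: L2_def circle_measurable_def)

lemma L2_integrable_mult:
  assumes "f \<in> L2" "g \<in> L2"
  shows "integrable arc (\<lambda>t. f (cis t) * cnj (g (cis t)))"
proof (rule Bochner_Integration.integrable_bound)
  show "integrable arc (\<lambda>t. (norm (f (cis t)))\<^sup>2 + (norm (g (cis t)))\<^sup>2)"
    using assms by (auto simp: L2_iff)
  have [measurable]: "(\<lambda>t. f (cis t)) \<in> borel_measurable arc" "(\<lambda>t. g (cis t)) \<in> borel_measurable arc"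
    using assms by (auto simp: L2_iff)
  show "(\<lambda>t. f (cis t) * cnj (g (cis t))) \<in> borel_measurable arc"
    by measurable
  have "a * b \<le> a\<^sup>2 + b\<^sup>2" if "a \<ge> 0" "b \<ge> 0" for a b :: real
    using that sum_squares_bound[of a b] mult_nonneg_nonneg[OF that] by linarith
  then show "AE t in arc. norm (f (cis t) * cnj (g (cis t))) \<le> norm ((norm (f (cis t)))\<^sup>2 + (norm (g (cis t)))\<^sup>2)"
    by (simp add: norm_mult)
qed

lemma L2_scale: "f \<in> L2 \<Longrightarrow> (\<lambda>z. c * f z) \<in> L2"
  by (auto simp: L2_iff norm_mult power_mult_distrib)

lemma L2_add:
  assumes "f \<in> L2" "g \<in> L2"
  shows "(\<lambda>z. f z + g z) \<in> L2"
proof -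
  have [measurable]: "(\<lambda>t. f (cis t)) \<in> borel_measurable arc" "(\<lambda>t. g (cis t)) \<in> borel_measurable arc"
    using assms by (auto simp: L2_iff)
  have "integrable arc (\<lambda>t. (norm (f (cis t) + g (cis t)))\<^sup>2)"
  proof (rule Bochner_Integration.integrable_bound)
    show "integrable arc (\<lambda>t. 2 * (norm (f (cis t)))\<^sup>2 + 2 * (norm (g (cis t)))\<^sup>2)"
      using assms by (auto simp: L2_iff)
    have "(norm (a + b))\<^sup>2 \<le> 2 * (norm a)\<^sup>2 + 2 * (norm b)\<^sup>2" for a b :: complex
    proof -
      have "(norm (a + b))\<^sup>2 \<le> (norm a + norm b)\<^sup>2"
        by (intro power_mono norm_triangle_ineq) auto
      also have "\<dots> \<le> 2 * (norm a)\<^sup>2 + 2 * (norm b)\<^sup>2"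
        using sum_squares_bound[of "norm a" "norm b"] by (simp add: power2_sum)
      finally show ?thesis .
    qed
    then show "AE t in arc. norm ((norm (f (cis t) + g (cis t)))\<^sup>2)
        \<le> norm (2 * (norm (f (cis t)))\<^sup>2 + 2 * (norm (g (cis t)))\<^sup>2)"
      by simp
  qed measurable
  then show ?thesis
    by (simp add: L2_iff)
qed

lemma L2_diff: "f \<in> L2 \<Longrightarrow> g \<in> L2 \<Longrightarrow> (\<lambda>z. f z - g z) \<in> L2"
  using L2_add[OF _ L2_scale[of g "-1"]] by simp

lemma L2_zero: "(\<lambda>z. 0) \<in> L2"
  by (simp add: L2_iff)

lemma L2_sum: "(\<And>i. i \<in> F \<Longrightarrow> f i \<in> L2) \<Longrightarrow> (\<lambda>z. \<Sum>i\<in>F. c i * f i z) \<in> L2"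
  by (induction F rule: infinite_finite_induct) (auto intro!: L2_zero L2_add L2_scale)

lemma L2_imp_circle_integrable:
  assumes "f \<in> L2"
  shows "circle_integrable f"
proof -
  have [measurable]: "(\<lambda>t. f (cis t)) \<in> borel_measurable arc"
    using assms by (simp add: L2_iff)
  have "integrable arc (\<lambda>t. norm (f (cis t)))"
    by (rule finite_measure.square_integrable_imp_integrable[OF arc_finite_measure])
      (use assms in \<open>simp_all add: L2_iff\<close>)
  then show ?thesis
    by (simp add: circle_integrable_def integrable_norm_iff)
qed

lemma L2_bounded:
  assumes "circle_measurable f" "\<And>t. norm (f (cis t)) \<le> B"
  shows "f \<in> L2"
proof -
  have [measurable]: "(\<lambda>t. f (cis t)) \<in> borel_measurable arc"
    using assms by (simp add: circle_measurable_def)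
  have "integrable arc (\<lambda>t. (norm (f (cis t)))\<^sup>2)"
    by (rule integrable_arc_bounded[where B = "B\<^sup>2"]) (use assms in \<open>auto intro!: power_mono\<close>)
  with assms show ?thesis by (simp add: L2_iff)
qed

lemma powi_measurable: "circle_measurable (\<lambda>z. z powi n)"
proof -
  have "continuous_on UNIV (\<lambda>t. cis t powi n)"
    by (intro continuous_intros) auto
  then show ?thesis by (simp add: circle_measurable_def measurable_arc_continuous)
qed

lemma L2_powi: "(\<lambda>z. z powi n) \<in> L2"
  by (rule L2_bounded[where B = 1]) (auto simp: powi_measurable norm_power_int)

lemma circle_inner_add_left:
  assumes "f \<in> L2" "g \<in> L2" "h \<in> L2"
  shows "circle_inner (\<lambda>z. f z + g z) h = circle_inner f h + circle_inner g h"
  using assms by (simp add: circle_inner_def ring_distribs L2_integrable_mult)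

lemma circle_inner_scale_left: "circle_inner (\<lambda>z. c * f z) h = c * circle_inner f h"
  by (simp add: circle_inner_def mult.assoc)

lemma circle_inner_zero_left: "circle_inner (\<lambda>z. 0) h = 0"
  by (simp add: circle_inner_def)

lemma circle_inner_diff_left:
  assumes "f \<in> L2" "g \<in> L2" "h \<in> L2"
  shows "circle_inner (\<lambda>z. f z - g z) h = circle_inner f h - circle_inner g h"
  using circle_inner_add_left[OF assms(1) L2_scale[OF assms(2), of "-1"] assms(3)]
    circle_inner_scale_left[of "-1" g h] by simp

lemma circle_inner_sum_left:
  assumes "\<And>i. i \<in> F \<Longrightarrow> f i \<in> L2" "h \<in> L2"
  shows "circle_inner (\<lambda>z. \<Sum>i\<in>F. c i * f i z) h = (\<Sum>i\<in>F. c i * circle_inner (f i) h)"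
  using assms(1)
  by (induction F rule: infinite_finite_induct)
    (auto simp: circle_inner_zero_left circle_inner_add_left circle_inner_scale_left
      L2_sum L2_scale assms(2))

lemma circle_inner_commute: "circle_inner g f = cnj (circle_inner f g)"
  unfolding circle_inner_def by (simp add: mult.commute flip: Bochner_Integration.integral_cnj)

lemma circle_inner_diff_right:
  assumes "f \<in> L2" "g \<in> L2" "h \<in> L2"
  shows "circle_inner h (\<lambda>z. f z - g z) = circle_inner h f - circle_inner h g"
  unfolding circle_inner_commute[of h] by (simp add: circle_inner_diff_left[OF assms])

lemma circle_inner_scale_right: "circle_inner h (\<lambda>z. c * f z) = cnj c * circle_inner h f"
  unfolding circle_inner_commute[of h] by (simp add: circle_inner_scale_left)

lemma circle_inner_sum_right:
  assumes "\<And>i. i \<in> F \<Longrightarrow> f i \<in> L2" "h \<in> L2"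
  shows "circle_inner h (\<lambda>z. \<Sum>i\<in>F. c i * f i z) = (\<Sum>i\<in>F. cnj (c i) * circle_inner h (f i))"
  using circle_inner_sum_left[OF assms, where c = c]
  unfolding circle_inner_commute[of h] by simp

section \<open>The L^2 norm and the Cauchy-Schwarz inequality\<close>

lemma circle_inner_self: "circle_inner f f = of_real (1 / (2 * pi) * (LINT t|arc. (norm (f (cis t)))\<^sup>2))"
  unfolding circle_inner_def complex_norm_square[symmetric] integral_complex_of_real by simp

lemma L2_norm_squared: "(L2_norm f)\<^sup>2 = 1 / (2 * pi) * (LINT t|arc. (norm (f (cis t)))\<^sup>2)"
  by (simp add: L2_norm_def circle_inner_self integral_nonneg_AE)

lemma circle_inner_self_norm: "circle_inner f f = of_real ((L2_norm f)\<^sup>2)"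
  by (simp add: L2_norm_squared circle_inner_self)

lemma L2_norm_nonneg: "L2_norm f \<ge> 0"
  by (simp add: L2_norm_def circle_inner_self integral_nonneg_AE)

text \<open>Kept as an identity of complex numbers so that the conjugate cross terms need not be
  rewritten as a real part. A variable scalar \<open>c\<close> gives Cauchy-Schwarz,
  \<open>c = 1\<close> the distance to a partial Fourier sum.\<close>

lemma L2_norm_diff_scale_squared:
  assumes "f \<in> L2" "g \<in> L2"
  shows "complex_of_real ((L2_norm (\<lambda>z. f z - c * g z))\<^sup>2) =
    of_real ((L2_norm f)\<^sup>2) - cnj c * circle_inner f g - c * cnj (circle_inner f g)
    + c * cnj c * of_real ((L2_norm g)\<^sup>2)"
  unfolding circle_inner_self_norm[symmetric] using assms
  by (simp add: circle_inner_diff_left circle_inner_diff_right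
      circle_inner_scale_left circle_inner_scale_right L2_diff L2_scale
      circle_inner_commute[of g f] algebra_simps)

lemma circle_inner_Cauchy_Schwarz:
  assumes "f \<in> L2" "g \<in> L2"
  shows "norm (circle_inner f g) \<le> L2_norm f * L2_norm g"
proof -
  define w where "w = circle_inner f g"
  have n2: "(complex_of_real (norm w))\<^sup>2 = w * cnj w"
    using complex_norm_square[of w] by simp
  \<comment> \<open>The scalar \<open>t * w\<close> has the phase of the inner product, so both
    cross terms become real and a real quadratic in \<open>t\<close> remains.\<close>
  have pos: "0 \<le> (L2_norm f)\<^sup>2 - 2 * t * (norm w)\<^sup>2 + t\<^sup>2 * (norm w)\<^sup>2 * (L2_norm g)\<^sup>2" for t :: real
  proof -
    have "of_real ((L2_norm (\<lambda>z. f z - (of_real t * w) * g z))\<^sup>2) =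
      complex_of_real ((L2_norm f)\<^sup>2 - 2 * t * (norm w)\<^sup>2 + t\<^sup>2 * (norm w)\<^sup>2 * (L2_norm g)\<^sup>2)"
      unfolding L2_norm_diff_scale_squared[OF assms] w_def[symmetric]
      by (simp add: n2 power2_eq_square[of "complex_of_real t"] algebra_simps)
    then have "(L2_norm (\<lambda>z. f z - (of_real t * w) * g z))\<^sup>2 =
      (L2_norm f)\<^sup>2 - 2 * t * (norm w)\<^sup>2 + t\<^sup>2 * (norm w)\<^sup>2 * (L2_norm g)\<^sup>2"
      by (simp only: of_real_eq_iff)
    then show ?thesis
      using zero_le_power2[of "L2_norm (\<lambda>z. f z - (of_real t * w) * g z)"] by linarith
  qed
  have "(norm w)\<^sup>2 \<le> (L2_norm f)\<^sup>2 * (L2_norm g)\<^sup>2"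
  proof (cases "L2_norm g = 0")
    case True
    have "norm w = 0"
    proof (rule ccontr)
      assume "norm w \<noteq> 0"
      then show False
        \<comment> \<open>With \<open>L2_norm g = 0\<close> the quadratic is affine in
          \<open>t\<close>; this \<open>t\<close> gives it the value -1.\<close>
        using pos[of "((L2_norm f)\<^sup>2 + 1) / (2 * (norm w)\<^sup>2)"] True by simp
    qed
    then show ?thesis by simp
  next
    case False
    \<comment> \<open>The value \<open>1 / (L2_norm g)\<^sup>2\<close> of \<open>t\<close> is where
      the quadratic is smallest.\<close>
    have eq: "2 * (1 / (L2_norm g)\<^sup>2) * (norm w)\<^sup>2 - (1 / (L2_norm g)\<^sup>2)\<^sup>2 * (norm w)\<^sup>2 * (L2_norm g)\<^sup>2
      = (norm w)\<^sup>2 / (L2_norm g)\<^sup>2"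
      using False by (simp add: field_simps power2_eq_square)
    have "(norm w)\<^sup>2 / (L2_norm g)\<^sup>2 \<le> (L2_norm f)\<^sup>2"
      using pos[of "1 / (L2_norm g)\<^sup>2"] eq by linarith
    then show ?thesis
      using False by (simp add: pos_divide_le_eq)
  qed
  then have "(norm w)\<^sup>2 \<le> (L2_norm f * L2_norm g)\<^sup>2"
    by (simp add: power_mult_distrib)
  then show ?thesis
    unfolding w_def by (rule power2_le_imp_le) (simp add: L2_norm_nonneg)
qed

section \<open>Invariance under changes on null sets, and orthonormality of the exponentials\<close>

lemma circle_inner_cong:
  assumes "circle_eq f g" "circle_measurable f" "circle_measurable g" "circle_measurable h"
  shows "circle_inner f h = circle_inner g h"
proof -
  have [measurable]: "(\<lambda>t. f (cis t)) \<in> borel_measurable arc" "(\<lambda>t. g (cis t)) \<in> borel_measurable arc"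
     "(\<lambda>t. h (cis t)) \<in> borel_measurable arc"
    using assms by (auto simp: circle_measurable_def)
  have "(LINT t|arc. f (cis t) * cnj (h (cis t))) = (LINT t|arc. g (cis t) * cnj (h (cis t)))"
    by (rule integral_cong_AE) (use assms(1) in \<open>auto simp: circle_eq_def\<close>)
  then show ?thesis by (simp add: circle_inner_def)
qed

lemma L2_norm_cong:
  assumes "circle_eq f g" "circle_measurable f" "circle_measurable g"
  shows "L2_norm f = L2_norm g"
proof -
  have [measurable]: "(\<lambda>t. f (cis t)) \<in> borel_measurable arc" "(\<lambda>t. g (cis t)) \<in> borel_measurable arc"
    using assms by (auto simp: circle_measurable_def)
  have "(LINT t|arc. (norm (f (cis t)))\<^sup>2) = (LINT t|arc. (norm (g (cis t)))\<^sup>2)"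
    by (rule integral_cong_AE) (use assms(1) in \<open>auto simp: circle_eq_def\<close>)
  then show ?thesis
    by (intro power2_eq_imp_eq[OF _ L2_norm_nonneg L2_norm_nonneg]) (simp add: L2_norm_squared)
qed

lemma circle_inner_powi: "circle_inner (\<lambda>z. z powi m) (\<lambda>z. z powi n) = (if m = n then 1 else 0)"
proof -
  define k where "k = m - n"
  have eq: "cis t powi m * cnj (cis t powi n) = cis (of_int k * t)" for t
    by (simp add: cis_power_int cis_cnj cis_mult k_def algebra_simps)
  have int: "((\<lambda>t. cis (of_int k * t)) has_integral (if k = 0 then of_real (2 * pi) else 0)) {0..2*pi}"
  proof (cases "k = 0")
    case True
    then show ?thesis
      using has_integral_const_real[of "1::complex" 0 "2*pi"] by (simp add: scaleR_conv_of_real)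
  next
    case False
    have "((\<lambda>t. cis (of_int k * t)) has_integral
        (cis (of_int k * (2*pi)) / (\<i> * of_int k) - cis (of_int k * 0) / (\<i> * of_int k))) {0..2*pi}"
    proof (rule fundamental_theorem_of_calculus)
      fix t assume "t \<in> {0..2*pi}"
      have "((\<lambda>t. exp (\<i> * (of_int k * t)) / (\<i> * of_int k)) has_vector_derivative
          exp (\<i> * (of_int k * t))) (at t within {0..2*pi})"
        using False by (auto intro!: derivative_eq_intros has_vector_derivative_real_field simp: field_simps)
      then show "((\<lambda>t. cis (of_int k * t) / (\<i> * of_int k)) has_vector_derivative cis (of_int k * t)) (at t within {0..2*pi})"
        by (simp add: cis_conv_exp)
    qed simp
    moreover have "cis (of_int k * (2*pi)) = 1"
      using cis_multiple_2pi[of "of_int k"] by (simp add: mult.commute mult.left_commute)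
    ultimately show ?thesis using False by simp
  qed
  have meas: "(\<lambda>t. cis (of_int k * t)) \<in> borel_measurable arc"
    by (intro measurable_arc_continuous continuous_intros)
  have "integrable arc (\<lambda>t. cis (of_int k * t))"
    by (rule integrable_arc_bounded[where B = 1]) (auto intro: meas)
  then have "(LINT t|arc. cis (of_int k * t)) = integral {0..2*pi} (\<lambda>t. cis (of_int k * t))"
    by (intro lebesgue_integral_eq_integral) auto
  also have "\<dots> = (if k = 0 then of_real (2 * pi) else 0)"
    using int by (rule integral_unique)
  finally show ?thesis
    unfolding circle_inner_def eq by (simp add: k_def del: complex_cnj_power_int)
qed

subsection \<open>Uniqueness of Fourier coefficients\<close>

lemma fourier_coeff_eq_integral:
  "fourier_coeff f n = 1 / (2 * pi) * (LINT t|arc. f (cis t) * cis (- (of_int n * t)))"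
  by (simp add: fourier_coeff_def circle_inner_def cis_power_int cis_cnj flip: complex_cnj_power_int)

lemma integrable_arc_mult_bounded:
  fixes f g :: "real \<Rightarrow> complex"
  assumes "integrable arc f" "g \<in> borel_measurable arc" "\<And>t. t \<in> {0..2*pi} \<Longrightarrow> norm (g t) \<le> B"
  shows "integrable arc (\<lambda>t. f t * g t)"
proof (rule Bochner_Integration.integrable_bound)
  show "integrable arc (\<lambda>t. norm (f t) * B)"
    using assms(1) by simp
  have [measurable]: "f \<in> borel_measurable arc" "g \<in> borel_measurable arc"
    using assms by auto
  show "(\<lambda>t. f t * g t) \<in> borel_measurable arc"
    by measurable
  have "norm (f t * g t) \<le> norm (norm (f t) * B)" if "t \<in> {0..2*pi}" for t
    unfolding norm_mult using assms(3)[OF that]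
    by (smt (verit) mult_left_mono norm_ge_zero real_norm_def abs_mult)
  then show "AE t in arc. norm (f t * g t) \<le> norm (norm (f t) * B)"
    by (intro AE_I2) simp
qed

lemma integrable_arc_mult_cis:
  assumes "integrable arc f"
  shows "integrable arc (\<lambda>t. f t * cis (a * t))"
  by (rule integrable_arc_mult_bounded[OF assms, where B = 1])
    (auto intro!: measurable_arc_continuous continuous_intros)

text \<open>Quantifying over \<open>f\<close> is what lets the product case of the induction go through.\<close>

lemma fourier_coeff_mult_polynomial_eq_0:
  fixes p :: "complex \<Rightarrow> real"
  assumes "real_polynomial_function p" "circle_integrable f" "\<And>n. fourier_coeff f n = 0"
  shows "circle_integrable (\<lambda>z. f z * p z) \<and> (\<forall>n. fourier_coeff (\<lambda>z. f z * p z) n = 0)"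
  using assms
proof (induction arbitrary: f rule: real_polynomial_function.induct)
  case (linear p)
  interpret bounded_linear p by fact
  \<comment> \<open>A real-linear \<open>p\<close> takes the value
    \<open>p 1 * cos t + p \<i> * sin t\<close> on the circle. Euler's formulas turn this into a
    combination of \<open>cis t\<close> and \<open>cis (- t)\<close> with conjugate coefficients
    \<open>c\<close> and \<open>cnj c\<close>.\<close>
  define c where "c = Complex (p 1 / 2) (- p \<i> / 2)"
  have int: "integrable arc (\<lambda>t. f (cis t))"
    using linear.prems by (simp add: circle_integrable_def)
  have p_cis: "complex_of_real (p (cis t)) = c * cis t + cnj c * cis (- t)" for t
  proof -
    have "cis t = Re (cis t) *\<^sub>R 1 + Im (cis t) *\<^sub>R \<i>"
      by (simp add: complex_eq_iff)
    then have "p (cis t) = cos t * p 1 + sin t * p \<i>"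
      by (metis add scaleR cis.simps real_scaleR_def)
    then show ?thesis
      by (simp add: complex_eq_iff c_def)
  qed
  have "f (cis t) * p (cis t) = c * (f (cis t) * cis (1 * t)) + cnj c * (f (cis t) * cis ((-1) * t))" for t
    by (simp add: p_cis algebra_simps)
  then have int': "circle_integrable (\<lambda>z. f z * p z)"
    unfolding circle_integrable_def
    using integrable_arc_mult_cis[OF int, of 1] integrable_arc_mult_cis[OF int, of "-1"] by simp
  have "fourier_coeff (\<lambda>z. f z * p z) n = 0" for n
  proof -
    \<comment> \<open>Multiplication by \<open>p\<close> combines the coefficients of
      \<open>f\<close> at \<open>n - 1\<close> and \<open>n + 1\<close>, both of which
      vanish.\<close>
    have shift: "cis ((- of_int (n - 1)) * t) = cis t * cis (- (of_int n * t))"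
       "cis ((- of_int (n + 1)) * t) = cis (- t) * cis (- (of_int n * t))" for t
      by (simp_all add: cis_mult algebra_simps)
    have "f (cis t) * p (cis t) * cis (- (of_int n * t)) =
        c * (f (cis t) * cis ((- of_int (n - 1)) * t)) + cnj c * (f (cis t) * cis ((- of_int (n + 1)) * t))" for t
      unfolding p_cis shift by (simp only: distrib_left distrib_right mult.assoc mult.left_commute)
    then have "(LINT t|arc. f (cis t) * p (cis t) * cis (- (of_int n * t))) =
       c * (LINT t|arc. f (cis t) * cis ((- of_int (n - 1)) * t)) +
       cnj c * (LINT t|arc. f (cis t) * cis ((- of_int (n + 1)) * t))"
      using integrable_arc_mult_cis[OF int, of "- of_int (n - 1)"]
         integrable_arc_mult_cis[OF int, of "- of_int (n + 1)"] by simp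
    also have "\<dots> = 0"
      using linear.prems(2)[of "n - 1", unfolded fourier_coeff_eq_integral minus_mult_left]
        linear.prems(2)[of "n + 1", unfolded fourier_coeff_eq_integral minus_mult_left] by simp
    finally show ?thesis
      by (simp add: fourier_coeff_eq_integral)
  qed
  with int' show ?case by simp
next
  case (const c)
  then show ?case
    by (simp add: circle_integrable_def fourier_coeff_eq_integral mult.assoc mult.left_commute)
next
  case (add p q)
  have p: "circle_integrable (\<lambda>z. f z * p z)" "\<And>n. fourier_coeff (\<lambda>z. f z * p z) n = 0"
   and q: "circle_integrable (\<lambda>z. f z * q z)" "\<And>n. fourier_coeff (\<lambda>z. f z * q z) n = 0"
    using add by auto
  have "integrable arc (\<lambda>t. f (cis t) * p (cis t) * cis (- (of_int n * t)))"
       "integrable arc (\<lambda>t. f (cis t) * q (cis t) * cis (- (of_int n * t)))" for n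
    using integrable_arc_mult_cis[of _ "- of_int n"] p(1) q(1) by (auto simp: circle_integrable_def)
  then show ?case
    using p q by (simp add: circle_integrable_def fourier_coeff_eq_integral ring_distribs)
next
  case (mult p q)
  then have "circle_integrable (\<lambda>z. f z * p z)" "\<And>n. fourier_coeff (\<lambda>z. f z * p z) n = 0"
    by auto
  then have "circle_integrable (\<lambda>z. (f z * p z) * q z) \<and> (\<forall>n. fourier_coeff (\<lambda>z. (f z * p z) * q z) n = 0)"
    using mult.IH(2) by blast
  then show ?case by (simp add: mult.assoc)
qed

text \<open>Polynomials in the two real coordinates are uniformly dense on the circle by
  Stone-Weierstrass. A uniform error \<open>e\<close> costs at most \<open>e\<close> times the L^1
  norm of \<open>f\<close>, so integrability of \<open>f\<close> is enough.\<close>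

lemma integral_mult_continuous_eq_0:
  assumes f: "circle_integrable f" "\<And>n. fourier_coeff f n = 0" and g: "continuous_on (sphere 0 1) g"
  shows "(LINT t|arc. f (cis t) * g (cis t)) = 0"
proof -
  have int: "integrable arc (\<lambda>t. f (cis t))"
    using f by (simp add: circle_integrable_def)
  have comp: "continuous_on UNIV (\<lambda>t. h (cis t))" if "continuous_on (sphere 0 1) h" for h :: "complex \<Rightarrow> complex"
    by (rule continuous_on_compose2[OF that]) (auto intro!: continuous_intros)
  have bound: "norm (LINT t|arc. f (cis t) * g (cis t)) \<le> (LINT t|arc. norm (f (cis t))) * e" if "e > 0" for e
  proof -
    obtain p :: "complex \<Rightarrow> complex" where p: "polynomial_function p" "\<And>z. z \<in> sphere 0 1 \<Longrightarrow> norm (g z - p z) < e"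
      using Stone_Weierstrass_polynomial_function[OF compact_sphere g \<open>e > 0\<close>] by blast
    have p_cont: "continuous_on (sphere 0 1) p"
      using p(1) by (rule continuous_on_polymonial_function)
    \<comment> \<open>The approximant is complex-valued, while the vanishing lemma treats real
      factors; real and imaginary parts are handled separately.\<close>
    have poly: "real_polynomial_function (\<lambda>z. Re (p z))" "real_polynomial_function (\<lambda>z. Im (p z))"
      using p(1) bounded_linear_Re bounded_linear_Im unfolding polynomial_function_def o_def by blast+
    have rp: "circle_integrable (\<lambda>z. f z * Re (p z))" "fourier_coeff (\<lambda>z. f z * Re (p z)) 0 = 0"
     and ip: "circle_integrable (\<lambda>z. f z * Im (p z))" "fourier_coeff (\<lambda>z. f z * Im (p z)) 0 = 0"
      using fourier_coeff_mult_polynomial_eq_0[OF _ f] poly by blast+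
    have "f z * p z = f z * Re (p z) + \<i> * (f z * Im (p z))" for z
      by (subst (1) complex_eq[of "p z"]) (simp add: algebra_simps)
    then have p0: "(LINT t|arc. f (cis t) * p (cis t)) = 0" and p_int: "integrable arc (\<lambda>t. f (cis t) * p (cis t))"
      using rp ip by (simp_all add: circle_integrable_def fourier_coeff_eq_integral)
    have diff_int: "integrable arc (\<lambda>t. f (cis t) * (g (cis t) - p (cis t)))"
      by (rule integrable_arc_mult_bounded[OF int, where B = e])
        (auto intro!: measurable_arc_continuous less_imp_le[OF p(2)] continuous_on_diff comp g p_cont)
    then have "integrable arc (\<lambda>t. f (cis t) * (g (cis t) - p (cis t)) + f (cis t) * p (cis t))"
      using p_int by (rule Bochner_Integration.integrable_add)
    then have "integrable arc (\<lambda>t. f (cis t) * g (cis t))"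
      by (simp add: algebra_simps)
    then have "(LINT t|arc. f (cis t) * g (cis t)) = (LINT t|arc. f (cis t) * (g (cis t) - p (cis t)))"
      using p_int p0 by (simp add: right_diff_distrib)
    also have "norm \<dots> \<le> (LINT t|arc. norm (f (cis t)) * e)"
    proof (rule Bochner_Integration.integral_norm_bound_integral[OF diff_int])
      show "norm (f (cis t) * (g (cis t) - p (cis t))) \<le> norm (f (cis t)) * e" for t
        unfolding norm_mult by (intro mult_left_mono less_imp_le[OF p(2)]) auto
    qed (use int in simp)
    finally show ?thesis by simp
  qed
  define C where "C = (LINT t|arc. norm (f (cis t)))"
  have "C \<ge> 0" by (simp add: C_def)
  have "norm (LINT t|arc. f (cis t) * g (cis t)) \<le> 0 + e" if "e > 0" for e
  proof -
    \<comment> \<open>\<open>C + 1\<close> rather than \<open>C\<close>, since \<open>C = 0\<close>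
      when \<open>f\<close> vanishes almost everywhere.\<close>
    have "e / (C + 1) > 0"
      using that \<open>C \<ge> 0\<close> by simp
    then have "norm (LINT t|arc. f (cis t) * g (cis t)) \<le> C * (e / (C + 1))"
      unfolding C_def by (rule bound)
    also have "\<dots> \<le> e"
      using that \<open>C \<ge> 0\<close> by (simp add: field_simps)
    finally show ?thesis by simp
  qed
  then show ?thesis
    using field_le_epsilon norm_le_zero_iff by blast
qed

text \<open>Transfers test functions built on the parameter interval to the circle, where
  Stone-Weierstrass was applied. The end points of the interval are glued, hence the condition on
  \<open>G\<close>.\<close>

lemma continuous_on_circle_lift:
  fixes G :: "real \<Rightarrow> 'a::topological_space"
  assumes cont: "continuous_on {0..2*pi} G" and per: "G 0 = G (2*pi)"
  obtains F where "continuous_on (sphere 0 1) F" "\<And>t. t \<in> {0..2*pi} \<Longrightarrow> F (cis t) = G t"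
proof
  \<comment> \<open>\<open>Arg2pi\<close> takes values in the half-open interval, so
    \<open>2*pi\<close> is the one parameter it does not recover; there \<open>per\<close> supplies
    the value.\<close>
  define F where "F = (\<lambda>z. G (Arg2pi z))"
  show F: "F (cis t) = G t" if "t \<in> {0..2*pi}" for t
  proof (cases "t = 2*pi")
    case True
    moreover have "Arg2pi 1 = 0"
      by (rule Arg2pi_unique[of 1]) auto
    ultimately show ?thesis using per by (simp add: F_def)
  next
    case False
    then have "Arg2pi (cis t) = t"
      using that by (intro Arg2pi_unique[of 1]) (auto simp: cis_conv_exp)
    then show ?thesis by (simp add: F_def)
  qed
  have sphere: "\<exists>t\<in>{0..2*pi}. z = cis t" if "z \<in> sphere 0 1" for z
  proof
    show "z = cis (Arg2pi z)"
      using Arg2pi_eq[of z] that by (simp add: cis_conv_exp)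
    show "Arg2pi z \<in> {0..2*pi}"
      using Arg2pi_ge_0[of z] Arg2pi_lt_2pi[of z] by simp
  qed
  text \<open>\<open>cis\<close> maps the compact interval onto the circle and hence is a closed map.\<close>
  show "continuous_on (sphere 0 1) F"
    unfolding continuous_on_closed_vimage[OF closed_sphere]
  proof (intro allI impI)
    fix B :: "'a set" assume "closed B"
    have "F -` B \<inter> sphere 0 1 = cis ` (G -` B \<inter> {0..2*pi})"
    proof (intro equalityI subsetI)
      fix z assume z: "z \<in> F -` B \<inter> sphere 0 1"
      then obtain t where "t \<in> {0..2*pi}" "z = cis t"
        using sphere by blast
      then show "z \<in> cis ` (G -` B \<inter> {0..2*pi})"
        using z F[of t] by auto
    qed (use F in auto)
    moreover have "closed (G -` B \<inter> {0..2*pi})"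
      using cont \<open>closed B\<close> continuous_on_closed_vimage by blast
    then have "compact (G -` B \<inter> {0..2*pi})"
      by (auto simp: compact_eq_bounded_closed intro: bounded_subset[OF bounded_closed_interval])
    then have "compact (cis ` (G -` B \<inter> {0..2*pi}))"
      by (intro compact_continuous_image continuous_intros)
    ultimately show "closed (F -` B \<inter> sphere 0 1)"
      by (simp add: compact_imp_closed)
  qed
qed

text \<open>\<open>cnj (sgn f)\<close> is an almost everywhere limit of continuous functions, which may be taken to be
  bounded by 1 and to vanish at the end points, so integrating \<open>f\<close> against them gives \<open>\<integral>\<bar>f\<bar> = 0\<close>.\<close>

lemma fourier_coeff_eq_0_imp_circle_eq_0:
  assumes f: "circle_integrable f" "\<And>n. fourier_coeff f n = 0"
  shows "circle_eq f (\<lambda>z. 0)"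
proof -
  have int: "integrable arc (\<lambda>t. f (cis t))"
    using f by (simp add: circle_integrable_def)
  then have [measurable]: "(\<lambda>t. f (cis t)) \<in> borel_measurable arc"
    by simp
  define h where "h = (\<lambda>t. cnj (sgn (f (cis t))))"
  have "h \<in> borel_measurable arc"
    unfolding h_def sgn_div_norm by measurable
  \<comment> \<open>\<open>measurable_on\<close> means being an almost everywhere limit of
    continuous functions, which is where the sequence \<open>g\<close> comes from.\<close>
  then have "h measurable_on {0..2*pi}"
    by (simp add: measurable_on_iff_borel_measurable)
  then obtain N g where N: "negligible N" and g: "\<And>n. continuous_on UNIV (g n)"
     and lim: "\<And>x. x \<notin> N \<Longrightarrow> (\<lambda>n. g n x) \<longlonglongrightarrow> (if x \<in> {0..2*pi} then h x else 0)"
    unfolding measurable_on_def by blast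
  \<comment> \<open>The first factor vanishes at both end points and equals 1 from some
    \<open>n\<close> on at each interior point. The second truncates \<open>g n\<close> to the unit
    disc, which leaves the limit unchanged because \<open>h\<close> has modulus at most 1.\<close>
  define G where "G = (\<lambda>n t. of_real (min 1 (real n * (t * (2*pi - t)))) * (g n t / of_real (max 1 (norm (g n t)))))"
  have G_cont: "continuous_on UNIV (G n)" for n
    unfolding G_def by (intro continuous_intros g) auto
  have G_bound: "norm (G n t) \<le> 1" if "t \<in> {0..2*pi}" for n t
  proof -
    have "\<bar>min 1 (real n * (t * (2*pi - t)))\<bar> \<le> 1"
      using that by (simp add: abs_le_iff min_le_iff_disj)
    moreover have "norm (g n t / of_real (max 1 (norm (g n t)))) \<le> 1"
      by (simp add: norm_divide divide_le_eq_1 less_max_iff_disj)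
    ultimately show ?thesis
      unfolding G_def norm_mult by (intro mult_le_one) auto
  qed
  have "G n 0 = G n (2*pi)" for n
    by (simp add: G_def)
  then have zero: "(LINT t|arc. f (cis t) * G n t) = 0" for n
  proof -
    obtain F where F: "continuous_on (sphere 0 1) F" "\<And>t. t \<in> {0..2*pi} \<Longrightarrow> F (cis t) = G n t"
      using continuous_on_circle_lift[of "G n"] G_cont \<open>G n 0 = G n (2*pi)\<close>
      by (metis continuous_on_subset subset_UNIV)
    have "(LINT t|arc. f (cis t) * G n t) = (LINT t|arc. f (cis t) * F (cis t))"
      by (rule Bochner_Integration.integral_cong) (use F in auto)
    then show ?thesis
      using integral_mult_continuous_eq_0[OF f F(1)] by simp
  qed
  have G_lim: "(\<lambda>n. G n t) \<longlonglongrightarrow> h t" if t: "t \<notin> N" "0 < t" "t < 2*pi" for t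
  proof -
    have "norm (h t) \<le> 1"
      by (simp add: h_def norm_sgn)
    have "(\<lambda>n. g n t / of_real (max 1 (norm (g n t)))) \<longlonglongrightarrow> h t / of_real (max 1 (norm (h t)))"
      using lim[OF t(1)] t by (intro tendsto_intros) auto
    then have "(\<lambda>n. g n t / of_real (max 1 (norm (g n t)))) \<longlonglongrightarrow> h t"
      using \<open>norm (h t) \<le> 1\<close> by (simp add: max_def split: if_splits)
    moreover have "(\<lambda>n. complex_of_real (min 1 (real n * (t * (2*pi - t))))) \<longlonglongrightarrow> 1"
    proof (rule tendsto_eventually)
      have "t * (2*pi - t) > 0" using t by simp
      then obtain m where m: "1 < real m * (t * (2*pi - t))"
        using reals_Archimedean3 by blast
      show "\<forall>\<^sub>F n in sequentially. complex_of_real (min 1 (real n * (t * (2*pi - t)))) = 1"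
        using eventually_ge_at_top[of m]
      proof eventually_elim
        case (elim n)
        then have "real m * (t * (2*pi - t)) \<le> real n * (t * (2*pi - t))"
          using \<open>t * (2*pi - t) > 0\<close> by (intro mult_right_mono) auto
        with m show ?case by simp
      qed
    qed
    ultimately show ?thesis
      unfolding G_def using tendsto_mult by fastforce
  qed
  have AE_lim: "AE t in arc. (\<lambda>n. f (cis t) * G n t) \<longlonglongrightarrow> f (cis t) * h t"
  proof -
    have "negligible (N \<union> {0, 2*pi})"
      using N by simp
    then have "AE t in lebesgue. t \<notin> N \<union> {0, 2*pi}"
      by (intro AE_not_in) (simp add: negligible_iff_null_sets)
    then have "AE t in lebesgue. t \<in> {0..2*pi} \<longrightarrow> (\<lambda>n. f (cis t) * G n t) \<longlonglongrightarrow> f (cis t) * h t"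
      by eventually_elim (auto intro!: tendsto_intros G_lim)
    then show ?thesis
      by (subst AE_restrict_space_iff) auto
  qed
  have fh: "f (cis t) * h t = of_real (norm (f (cis t)))" for t
    unfolding h_def sgn_div_norm using complex_norm_square[of "f (cis t)"]
    by (simp add: scaleR_conv_of_real divide_simps power2_eq_square)
  have "(\<lambda>n. LINT t|arc. f (cis t) * G n t) \<longlonglongrightarrow> (LINT t|arc. f (cis t) * h t)"
  proof (rule integral_dominated_convergence[where w = "\<lambda>t. norm (f (cis t))"])
    show "(\<lambda>t. f (cis t) * h t) \<in> borel_measurable arc"
      unfolding fh by measurable
    show "(\<lambda>t. f (cis t) * G n t) \<in> borel_measurable arc" for n
      using measurable_arc_continuous[OF G_cont[of n]] by measurable
    show "AE t in arc. norm (f (cis t) * G n t) \<le> norm (f (cis t))" for n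
      using G_bound by (intro AE_I2) (simp add: norm_mult mult_left_le)
  qed (use int AE_lim in simp_all)
  then have "(LINT t|arc. norm (f (cis t))) = 0"
    by (simp add: zero fh LIMSEQ_const_iff)
  then have "AE t in arc. norm (f (cis t)) = 0"
    using int by (subst (asm) integral_nonneg_eq_0_iff_AE) auto
  then show ?thesis
    by (simp add: circle_eq_def)
qed

corollary fourier_coeff_eq_imp_circle_eq:
  assumes "circle_integrable f" "circle_integrable g" "\<And>n. fourier_coeff f n = fourier_coeff g n"
  shows "circle_eq f g"
proof -
  have int: "integrable arc (\<lambda>t. f (cis t))" "integrable arc (\<lambda>t. g (cis t))"
    using assms by (auto simp: circle_integrable_def)
  have "fourier_coeff (\<lambda>z. f z - g z) n = fourier_coeff f n - fourier_coeff g n" for n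
    using integrable_arc_mult_cis[OF int(1), of "- of_int n"] integrable_arc_mult_cis[OF int(2), of "- of_int n"]
    by (simp add: fourier_coeff_eq_integral left_diff_distrib right_diff_distrib)
  then have "circle_eq (\<lambda>z. f z - g z) (\<lambda>z. 0)"
    using assms int by (intro fourier_coeff_eq_0_imp_circle_eq_0) (auto simp: circle_integrable_def)
  then show ?thesis
    by (simp add: circle_eq_def)
qed

subsection \<open>Riesz-Fischer and Parseval\<close>

text \<open>The index set is arbitrary so that the difference of two symmetric partial sums is again
  of this form, and so that Bessel's inequality bounds every finite subsum, as unordered summability
  requires.\<close>

definition trig_sum :: "(int \<Rightarrow> complex) \<Rightarrow> int set \<Rightarrow> complex \<Rightarrow> complex" where
  "trig_sum c F = (\<lambda>z. \<Sum>k\<in>F. c k * z powi k)"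

lemma L2_trig_sum: "trig_sum c F \<in> L2"
  unfolding trig_sum_def by (intro L2_sum L2_powi)

lemma fourier_coeff_trig_sum:
  assumes "finite F"
  shows "fourier_coeff (trig_sum c F) n = (if n \<in> F then c n else 0)"
  using assms unfolding fourier_coeff_def trig_sum_def
  by (subst circle_inner_sum_left) (simp_all add: L2_powi circle_inner_powi if_distrib cong: if_cong)

lemma circle_inner_trig_sum_right:
  assumes "f \<in> L2"
  shows "circle_inner f (trig_sum c F) = (\<Sum>k\<in>F. cnj (c k) * fourier_coeff f k)"
  unfolding fourier_coeff_def trig_sum_def by (rule circle_inner_sum_right) (simp_all add: assms L2_powi)

lemma L2_norm_trig_sum_squared:
  assumes "finite F"
  shows "(L2_norm (trig_sum c F))\<^sup>2 = (\<Sum>k\<in>F. (norm (c k))\<^sup>2)"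
proof -
  have "complex_of_real ((L2_norm (trig_sum c F))\<^sup>2) = (\<Sum>k\<in>F. cnj (c k) * c k)"
    unfolding circle_inner_self_norm[symmetric] circle_inner_trig_sum_right[OF L2_trig_sum]
    using assms by (intro sum.cong) (auto simp: fourier_coeff_trig_sum)
  also have "\<dots> = complex_of_real (\<Sum>k\<in>F. (norm (c k))\<^sup>2)"
    unfolding of_real_sum complex_norm_square by (simp add: mult.commute)
  finally show ?thesis by (simp only: of_real_eq_iff)
qed

text \<open>Pythagoras for the orthogonal projection onto the span of the exponentials in
  \<open>F\<close>. The right-hand side sees \<open>f\<close> only through its norm and
  coefficients, which later lets convergence pass from one function to another.\<close>

lemma L2_norm_minus_trig_sum_squared:
  assumes "f \<in> L2" "finite F"
  shows "(L2_norm (\<lambda>z. f z - trig_sum (fourier_coeff f) F z))\<^sup>2 =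
    (L2_norm f)\<^sup>2 - (\<Sum>k\<in>F. (norm (fourier_coeff f k))\<^sup>2)"
proof -
  define s where "s = (\<Sum>k\<in>F. (norm (fourier_coeff f k))\<^sup>2)"
  have "circle_inner f (trig_sum (fourier_coeff f) F) = complex_of_real s"
    unfolding circle_inner_trig_sum_right[OF assms(1)] s_def of_real_sum complex_norm_square
    by (simp add: mult.commute)
  then have "complex_of_real ((L2_norm (\<lambda>z. f z - 1 * trig_sum (fourier_coeff f) F z))\<^sup>2) =
      of_real ((L2_norm f)\<^sup>2) - cnj 1 * of_real s - 1 * cnj (of_real s) + 1 * cnj 1 * of_real s"
    using L2_norm_diff_scale_squared[OF assms(1) L2_trig_sum, of 1 "fourier_coeff f" F]
    by (simp only: L2_norm_trig_sum_squared[OF assms(2)] s_def)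
  also have "\<dots> = complex_of_real ((L2_norm f)\<^sup>2 - s)"
    by simp
  finally have "complex_of_real ((L2_norm (\<lambda>z. f z - 1 * trig_sum (fourier_coeff f) F z))\<^sup>2) =
      complex_of_real ((L2_norm f)\<^sup>2 - s)" .
  then show ?thesis
    unfolding of_real_eq_iff by (simp add: s_def)
qed

lemma Bessel_inequality:
  assumes "f \<in> L2" "finite F"
  shows "(\<Sum>k\<in>F. (norm (fourier_coeff f k))\<^sup>2) \<le> (L2_norm f)\<^sup>2"
  using L2_norm_minus_trig_sum_squared[OF assms]
    zero_le_power2[of "L2_norm (\<lambda>z. f z - trig_sum (fourier_coeff f) F z)"] by linarith

lemma fourier_coeff_square_summable:
  assumes "f \<in> L2"
  shows "(\<lambda>n. (norm (fourier_coeff f n))\<^sup>2) summable_on UNIV"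
  by (rule nonneg_bdd_above_summable_on)
    (auto intro!: bdd_aboveI2[where M = "(L2_norm f)\<^sup>2"] Bessel_inequality assms)

lemma L2_norm_powi: "L2_norm (\<lambda>z. z powi n) = 1"
  by (simp add: L2_norm_def circle_inner_powi)

lemma norm_fourier_coeff_le:
  assumes "f \<in> L2"
  shows "norm (fourier_coeff f n) \<le> L2_norm f"
  using circle_inner_Cauchy_Schwarz[OF assms L2_powi, of n] by (simp add: L2_norm_powi fourier_coeff_def)

text \<open>Cauchy-Schwarz against the constant 1, in the guise of the zeroth Fourier coefficient of
  the modulus of \<open>f\<close>. It turns L^2-Cauchy into L^1-Cauchy.\<close>

lemma L1_norm_le_L2_norm:
  assumes "f \<in> L2"
  shows "(LINT t|arc. norm (f (cis t))) \<le> 2 * pi * L2_norm f"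
proof -
  have [measurable]: "(\<lambda>t. f (cis t)) \<in> borel_measurable arc"
    using assms by (simp add: L2_iff)
  define a where "a = (\<lambda>z. complex_of_real (norm (f z)))"
  have a: "a \<in> L2"
    using assms by (simp add: a_def L2_iff)
  have "L2_norm a = L2_norm f"
    by (intro power2_eq_imp_eq[OF _ L2_norm_nonneg L2_norm_nonneg]) (simp add: L2_norm_squared a_def)
  then have "norm (fourier_coeff a 0) \<le> L2_norm f"
    using norm_fourier_coeff_le[OF a] by metis
  moreover have "fourier_coeff a 0 = of_real (1 / (2 * pi) * (LINT t|arc. norm (f (cis t))))"
    by (simp add: fourier_coeff_eq_integral a_def)
  ultimately show ?thesis
    by (simp add: field_simps abs_mult norm_mult norm_divide)
qed

text \<open>\<open>has_sum\<close> is a limit along all finite sets of indices; this extracts the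
  sequence of symmetric partial sums from it.\<close>

lemma filterlim_symmetric_interval:
  "filterlim (\<lambda>n. {- int n..int n}) (finite_subsets_at_top UNIV) sequentially"
  unfolding filterlim_finite_subsets_at_top
proof (intro allI impI)
  fix X :: "int set" assume "finite X \<and> X \<subseteq> UNIV"
  \<comment> \<open>The sum of the absolute values bounds each of them, also when \<open>X\<close>
    is empty.\<close>
  then have X: "x \<in> X \<Longrightarrow> nat \<bar>x\<bar> \<le> (\<Sum>x\<in>X. nat \<bar>x\<bar>)" for x
    by (intro member_le_sum) auto
  show "\<forall>\<^sub>F n in sequentially. finite {- int n..int n} \<and> X \<subseteq> {- int n..int n} \<and> {- int n..int n} \<subseteq> UNIV"
    using eventually_ge_at_top[of "\<Sum>x\<in>X. nat \<bar>x\<bar>"]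
    by eventually_elim (use X in force)
qed

text \<open>The partial sums are Cauchy in L^2, hence in L^1, so a subsequence converges almost
  everywhere; Fatou's lemma then controls the L^2 distance to its limit. The convergence is part of
  the conclusion because the expansion of a given function is derived from it.\<close>

theorem Riesz_Fischer:
  assumes "(\<lambda>n. (norm (c n))\<^sup>2) summable_on UNIV"
  obtains g where "g \<in> L2" "\<And>n. fourier_coeff g n = c n"
    "(\<lambda>n. L2_norm (\<lambda>z. g z - trig_sum c {- int n..int n} z)) \<longlonglongrightarrow> 0"
proof -
  define P where "P = (\<lambda>n. trig_sum c {- int n..int n})"
  define s where "s = (\<lambda>n. \<Sum>k\<in>{- int n..int n}. (norm (c k))\<^sup>2)"
  obtain S where "((\<lambda>n. (norm (c n))\<^sup>2) has_sum S) UNIV"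
    using assms by (auto simp: summable_on_def)
  then have s_lim: "s \<longlonglongrightarrow> S"
    unfolding has_sum_def s_def by (rule filterlim_compose[OF _ filterlim_symmetric_interval])
  have P_L2: "P n \<in> L2" for n
    by (simp add: P_def L2_trig_sum)
  have P_meas [measurable]: "(\<lambda>t. P n (cis t)) \<in> borel_measurable arc" for n
    using P_L2[of n] by (simp add: L2_iff)
  have diff_le: "(L2_norm (\<lambda>z. P n z - P m z))\<^sup>2 = \<bar>s n - s m\<bar>" if "m \<le> n" for m n
  proof -
    have sub: "{- int m..int m} \<subseteq> {- int n..int n}" using that by auto
    have "(\<lambda>z. P n z - P m z) = trig_sum c ({- int n..int n} - {- int m..int m})"
      by (simp add: P_def trig_sum_def sum_diff[OF _ sub])
    moreover have "s n - s m = (\<Sum>k\<in>{- int n..int n} - {- int m..int m}. (norm (c k))\<^sup>2)"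
      by (simp add: s_def sum_diff[OF _ sub])
    ultimately show ?thesis
      by (simp add: L2_norm_trig_sum_squared sum_nonneg)
  qed
  have diff: "(L2_norm (\<lambda>z. P n z - P m z))\<^sup>2 = \<bar>s n - s m\<bar>" for m n
  proof (cases "m \<le> n")
    case False
    have "(L2_norm (\<lambda>z. P n z - P m z))\<^sup>2 = (L2_norm (\<lambda>z. P m z - P n z))\<^sup>2"
      by (simp add: L2_norm_squared norm_minus_commute)
    with False diff_le[of n m] show ?thesis by (simp add: abs_minus_commute)
  qed (simp add: diff_le)
  obtain r where r: "strict_mono r" "AE t in arc. Cauchy (\<lambda>k. P (r k) (cis t))"
  proof (rule cauchy_L1_AE_cauchy_subseq[of arc "\<lambda>n t. P n (cis t)"])
    show "integrable arc (\<lambda>t. P n (cis t))" for n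
      using L2_imp_circle_integrable[OF P_L2] by (simp add: circle_integrable_def)
    fix e :: real assume "e > 0"
    then have "(e / (2 * pi))\<^sup>2 > 0" by simp
    then obtain N where N: "\<And>i j. i \<ge> N \<Longrightarrow> j \<ge> N \<Longrightarrow> \<bar>s i - s j\<bar> < (e / (2 * pi))\<^sup>2"
      using LIMSEQ_imp_Cauchy[OF s_lim] unfolding Cauchy_def dist_real_def by meson
    have "(LINT t|arc. norm (P i (cis t) - P j (cis t))) < e" if "i \<ge> N" "j \<ge> N" for i j
    proof -
      have "L2_norm (\<lambda>z. P i z - P j z) < e / (2 * pi)"
        by (rule power2_less_imp_less) (use N[OF that] \<open>e > 0\<close> in \<open>simp_all add: diff\<close>)
      then show ?thesis
        using L1_norm_le_L2_norm[OF L2_diff[OF P_L2 P_L2], of i j] by (simp add: field_simps)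
    qed
    then show "\<exists>N. \<forall>i\<ge>N. \<forall>j\<ge>N. (LINT t|arc. norm (P i (cis t) - P j (cis t))) < e"
      by blast
  qed
  \<comment> \<open>Where the subsequence diverges, \<open>lim\<close> is an unspecified value; on
    the circle this happens only on a null set.\<close>
  define g where "g = (\<lambda>z. lim (\<lambda>k. P (r k) z))"
  have g_meas [measurable]: "(\<lambda>t. g (cis t)) \<in> borel_measurable arc"
    unfolding g_def by measurable
  have g_lim: "AE t in arc. (\<lambda>k. P (r k) (cis t)) \<longlonglongrightarrow> g (cis t)"
    using r(2) unfolding g_def by eventually_elim (simp add: Cauchy_convergent_iff convergent_LIMSEQ_iff)
  have sq: "(\<integral>\<^sup>+t. ennreal ((norm (h (cis t)))\<^sup>2) \<partial>arc) = ennreal (2 * pi * (L2_norm h)\<^sup>2)" if "h \<in> L2" for h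
    using that by (subst nn_integral_eq_integral) (auto simp: L2_iff L2_norm_squared)
  \<comment> \<open>Only the second index runs along the subsequence; \<open>n\<close> stays
    arbitrary, so the estimate reaches the full sequence of partial sums.\<close>
  have Fatou: "(\<integral>\<^sup>+t. ennreal ((norm (P n (cis t) - g (cis t)))\<^sup>2) \<partial>arc) \<le> ennreal (2 * pi * \<bar>s n - S\<bar>)" for n
  proof -
    have "(\<integral>\<^sup>+t. ennreal ((norm (P n (cis t) - g (cis t)))\<^sup>2) \<partial>arc) =
        (\<integral>\<^sup>+t. liminf (\<lambda>k. ennreal ((norm (P n (cis t) - P (r k) (cis t)))\<^sup>2)) \<partial>arc)"
    proof (rule nn_integral_cong_AE)
      show "AE t in arc. ennreal ((norm (P n (cis t) - g (cis t)))\<^sup>2) =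
        liminf (\<lambda>k. ennreal ((norm (P n (cis t) - P (r k) (cis t)))\<^sup>2))"
        using g_lim
        by eventually_elim (intro lim_imp_Liminf[symmetric] tendsto_intros tendsto_ennrealI, auto)
    qed
    also have "\<dots> \<le> liminf (\<lambda>k. \<integral>\<^sup>+t. ennreal ((norm (P n (cis t) - P (r k) (cis t)))\<^sup>2) \<partial>arc)"
      by (rule nn_integral_liminf) measurable
    also have "\<dots> = liminf (\<lambda>k. ennreal (2 * pi * \<bar>s n - s (r k)\<bar>))"
      using sq[OF L2_diff[OF P_L2 P_L2]] by (simp add: diff)
    also have "\<dots> = ennreal (2 * pi * \<bar>s n - S\<bar>)"
      using LIMSEQ_subseq_LIMSEQ[OF s_lim r(1)]
      by (intro lim_imp_Liminf tendsto_ennrealI tendsto_intros) (auto simp: o_def)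
    finally show ?thesis .
  qed
  have diff_L2: "(\<lambda>z. P n z - g z) \<in> L2" for n
    unfolding L2_iff
  proof
    show "integrable arc (\<lambda>t. (norm (P n (cis t) - g (cis t)))\<^sup>2)"
      using Fatou[of n] by (intro integrableI_bounded) (auto simp: top_unique less_top[symmetric] le_less_trans)
  qed measurable
  have g_L2: "g \<in> L2"
    using L2_diff[OF P_L2[of 0] diff_L2[of 0]] by simp
  have norm_le: "(L2_norm (\<lambda>z. g z - P n z))\<^sup>2 \<le> \<bar>s n - S\<bar>" for n
  proof -
    have "2 * pi * (L2_norm (\<lambda>z. P n z - g z))\<^sup>2 \<le> 2 * pi * \<bar>s n - S\<bar>"
      using Fatou[of n] sq[OF diff_L2[of n]] by simp
    then have "(L2_norm (\<lambda>z. P n z - g z))\<^sup>2 \<le> \<bar>s n - S\<bar>"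
      by simp
    then show ?thesis
      by (simp add: L2_norm_squared norm_minus_commute)
  qed
  have "(\<lambda>n. \<bar>s n - S\<bar>) \<longlonglongrightarrow> 0"
    using s_lim by (simp add: LIM_zero_iff tendsto_rabs_zero_iff)
  then have "(\<lambda>n. (L2_norm (\<lambda>z. g z - P n z))\<^sup>2) \<longlonglongrightarrow> 0"
    by (rule tendsto_sandwich[OF _ _ tendsto_const, rotated 2]) (simp_all add: norm_le)
  then have conv: "(\<lambda>n. L2_norm (\<lambda>z. g z - P n z)) \<longlonglongrightarrow> 0"
    using tendsto_real_sqrt by (fastforce simp: L2_norm_nonneg)
  have "fourier_coeff g n = c n" for n
  proof -
    \<comment> \<open>Taking a coefficient is a contraction in the L^2 norm, while the
      \<open>n\<close>-th coefficient of \<open>P m\<close> is \<open>c n\<close> for all large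
      \<open>m\<close>.\<close>
    have "(\<lambda>m. fourier_coeff g n - fourier_coeff (P m) n) \<longlonglongrightarrow> 0"
    proof (rule Lim_null_comparison[OF _ conv], intro always_eventually allI)
      fix m
      have "fourier_coeff g n - fourier_coeff (P m) n = fourier_coeff (\<lambda>z. g z - P m z) n"
        unfolding fourier_coeff_def by (rule circle_inner_diff_left[symmetric]) (intro g_L2 P_L2 L2_powi)+
      then show "norm (fourier_coeff g n - fourier_coeff (P m) n) \<le> L2_norm (\<lambda>z. g z - P m z)"
        by (simp add: norm_fourier_coeff_le L2_diff g_L2 P_L2)
    qed
    moreover have "(\<lambda>m. fourier_coeff g n - fourier_coeff (P m) n) \<longlonglongrightarrow> fourier_coeff g n - c n"
    proof (rule tendsto_eventually)
      show "\<forall>\<^sub>F m in sequentially. fourier_coeff g n - fourier_coeff (P m) n = fourier_coeff g n - c n"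
        using eventually_ge_at_top[of "nat \<bar>n\<bar>"]
        by eventually_elim (auto simp: P_def fourier_coeff_trig_sum)
    qed
    ultimately show ?thesis
      using LIMSEQ_unique by fastforce
  qed
  with g_L2 conv show thesis
    using that by (simp add: P_def)
qed

section \<open>Square integrability from coefficients, convergence of the series, Parseval\<close>

lemma circle_eq_imp_L2:
  assumes "circle_eq f g" "circle_measurable f" "g \<in> L2"
  shows "f \<in> L2"
proof -
  have [measurable]: "(\<lambda>t. f (cis t)) \<in> borel_measurable arc" "(\<lambda>t. g (cis t)) \<in> borel_measurable arc"
    using assms by (auto simp: circle_measurable_def L2_iff)
  have "integrable arc (\<lambda>t. (norm (f (cis t)))\<^sup>2) \<longleftrightarrow> integrable arc (\<lambda>t. (norm (g (cis t)))\<^sup>2)"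
    by (rule integrable_cong_AE) (use assms(1) in \<open>auto simp: circle_eq_def\<close>)
  with assms show ?thesis
    by (simp add: L2_iff circle_measurable_def)
qed

lemma L2_iff_fourier_coeff_square_summable:
  assumes "circle_measurable f"
  shows "f \<in> L2 \<longleftrightarrow> circle_integrable f \<and> (\<lambda>n. (norm (fourier_coeff f n))\<^sup>2) summable_on UNIV"
proof
  assume *: "circle_integrable f \<and> (\<lambda>n. (norm (fourier_coeff f n))\<^sup>2) summable_on UNIV"
  then obtain g where "g \<in> L2" "\<And>n. fourier_coeff g n = fourier_coeff f n"
    using Riesz_Fischer[of "fourier_coeff f"] by blast
  then show "f \<in> L2"
    using * assms by (intro circle_eq_imp_L2[of f g] fourier_coeff_eq_imp_circle_eq)
      (auto intro: L2_imp_circle_integrable)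
qed (auto intro: L2_imp_circle_integrable fourier_coeff_square_summable)

lemma fourier_series_tendsto:
  assumes "f \<in> L2"
  shows "(\<lambda>n. L2_norm (\<lambda>z. f z - trig_sum (fourier_coeff f) {- int n..int n} z)) \<longlonglongrightarrow> 0"
proof -
  obtain g where g: "g \<in> L2" "fourier_coeff g = fourier_coeff f"
    "(\<lambda>n. L2_norm (\<lambda>z. g z - trig_sum (fourier_coeff f) {- int n..int n} z)) \<longlonglongrightarrow> 0"
    using Riesz_Fischer[OF fourier_coeff_square_summable[OF assms]] by (metis ext)
  have "circle_eq f g"
    using assms g by (intro fourier_coeff_eq_imp_circle_eq) (auto intro: L2_imp_circle_integrable)
  then have "L2_norm f = L2_norm g"
    using assms g by (intro L2_norm_cong) (auto simp: L2_def)
  \<comment> \<open>By the Pythagorean identity both distances depend only on the norm and the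
    coefficients, which \<open>f\<close> and \<open>g\<close> share.\<close>
  then have "(L2_norm (\<lambda>z. f z - trig_sum (fourier_coeff f) {- int n..int n} z))\<^sup>2 =
     (L2_norm (\<lambda>z. g z - trig_sum (fourier_coeff f) {- int n..int n} z))\<^sup>2" for n
    using L2_norm_minus_trig_sum_squared[OF assms, of "{- int n..int n}"]
      L2_norm_minus_trig_sum_squared[OF g(1), of "{- int n..int n}"]
    by (simp add: g(2))
  then show ?thesis
    using g(3) by (simp add: power2_eq_iff_nonneg L2_norm_nonneg)
qed

theorem Parseval_identity:
  assumes "f \<in> L2"
  shows "((\<lambda>n. (norm (fourier_coeff f n))\<^sup>2) has_sum (L2_norm f)\<^sup>2) UNIV"
proof -
  obtain S where S: "((\<lambda>n. (norm (fourier_coeff f n))\<^sup>2) has_sum S) UNIV"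
    using fourier_coeff_square_summable[OF assms] by (auto simp: summable_on_def)
  then have "(\<lambda>n. \<Sum>k\<in>{- int n..int n}. (norm (fourier_coeff f k))\<^sup>2) \<longlonglongrightarrow> S"
    unfolding has_sum_def by (rule filterlim_compose[OF _ filterlim_symmetric_interval])
  moreover have "(\<lambda>n. (L2_norm f)\<^sup>2 - (L2_norm (\<lambda>z. f z - trig_sum (fourier_coeff f) {- int n..int n} z))\<^sup>2)
      \<longlonglongrightarrow> (L2_norm f)\<^sup>2 - 0\<^sup>2"
    by (intro tendsto_intros fourier_series_tendsto assms)
  then have "(\<lambda>n. \<Sum>k\<in>{- int n..int n}. (norm (fourier_coeff f k))\<^sup>2) \<longlonglongrightarrow> (L2_norm f)\<^sup>2"
    by (simp add: L2_norm_minus_trig_sum_squared[OF assms])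
  ultimately have "S = (L2_norm f)\<^sup>2"
    by (rule LIMSEQ_unique)
  with S show ?thesis by simp
qed

subsection \<open>The Hardy space\<close>

lemma hardy_basis_eq_powi: "hardy_basis n = (\<lambda>z. z powi int n)"
  by (simp add: hardy_basis_def)

lemma circle_inner_hardy_basis: "circle_inner f (hardy_basis n) = fourier_coeff f (int n)"
  by (simp add: fourier_coeff_def hardy_basis_eq_powi)

lemma H2_imp_L2: "f \<in> H2 \<Longrightarrow> f \<in> L2"
  by (simp add: H2_def)

lemma H2_add: "f \<in> H2 \<Longrightarrow> g \<in> H2 \<Longrightarrow> (\<lambda>z. f z + g z) \<in> H2"
  by (simp add: H2_def L2_add fourier_coeff_def circle_inner_add_left L2_powi)

lemma H2_scale: "f \<in> H2 \<Longrightarrow> (\<lambda>z. c * f z) \<in> H2"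
  by (simp add: H2_def L2_scale fourier_coeff_def circle_inner_scale_left)

lemma H2_zero: "(\<lambda>z. 0) \<in> H2"
  by (simp add: H2_def L2_zero fourier_coeff_def circle_inner_zero_left)

lemma H2_diff: "f \<in> H2 \<Longrightarrow> g \<in> H2 \<Longrightarrow> (\<lambda>z. f z - g z) \<in> H2"
  using H2_add[OF _ H2_scale[of g "-1"]] by simp

lemma H2_sum: "(\<And>i. i \<in> F \<Longrightarrow> f i \<in> H2) \<Longrightarrow> (\<lambda>z. \<Sum>i\<in>F. c i * f i z) \<in> H2"
  by (induction F rule: infinite_finite_induct) (auto intro!: H2_zero H2_add H2_scale)

lemma H2_hardy_basis: "hardy_basis n \<in> H2"
  unfolding H2_def hardy_basis_eq_powi
  by (auto simp: L2_powi fourier_coeff_def circle_inner_powi simp del: power_int_of_nat)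

lemma L2_hardy_basis: "hardy_basis n \<in> L2"
  by (rule H2_imp_L2[OF H2_hardy_basis])

lemma circle_inner_hardy_basis_hardy_basis:
  "circle_inner (hardy_basis m) (hardy_basis n) = (if m = n then 1 else 0)"
  unfolding hardy_basis_eq_powi circle_inner_powi by simp

lemma has_sum_nonneg_int:
  fixes f :: "int \<Rightarrow> 'a::{topological_comm_monoid_add, t2_space}"
  assumes "\<And>n. n < 0 \<Longrightarrow> f n = 0"
  shows "(f has_sum S) UNIV \<longleftrightarrow> ((\<lambda>n. f (int n)) has_sum S) UNIV"
proof -
  have "(f has_sum S) UNIV \<longleftrightarrow> (f has_sum S) (range int)"
  proof (rule has_sum_cong_neutral)
    fix n assume "n \<in> UNIV - range int"
    then show "f n = 0"
      using assms by (metis DiffE nonneg_int_cases not_le rangeI)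
  qed auto
  also have "\<dots> \<longleftrightarrow> ((\<lambda>n. f (int n)) has_sum S) UNIV"
    by (subst has_sum_reindex) (auto simp: o_def inj_on_def)
  finally show ?thesis .
qed

lemma H2_Parseval:
  assumes "f \<in> H2"
  shows "((\<lambda>n. (norm (circle_inner f (hardy_basis n)))\<^sup>2) has_sum (L2_norm f)\<^sup>2) UNIV"
  using Parseval_identity[OF H2_imp_L2[OF assms]] assms
  by (subst (asm) has_sum_nonneg_int) (auto simp: H2_def circle_inner_hardy_basis)

lemma H2_series_tendsto:
  assumes "f \<in> H2"
  shows "(\<lambda>n. L2_norm (\<lambda>z. f z - (\<Sum>j<Suc n. circle_inner f (hardy_basis j) * hardy_basis j z))) \<longlonglongrightarrow> 0"
proof -
  \<comment> \<open>The terms of negative index vanish on \<open>H2\<close>. The symmetric interval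
    contains \<open>n\<close> itself, hence the bound \<open>Suc n\<close>.\<close>
  have "trig_sum (fourier_coeff f) {- int n..int n} z =
      (\<Sum>j<Suc n. circle_inner f (hardy_basis j) * hardy_basis j z)" for n z
  proof -
    have "trig_sum (fourier_coeff f) {- int n..int n} z = (\<Sum>k\<in>int ` {..<Suc n}. fourier_coeff f k * z powi k)"
      unfolding trig_sum_def
    proof (rule sum.mono_neutral_right)
      show "\<forall>k\<in>{- int n..int n} - int ` {..<Suc n}. fourier_coeff f k * z powi k = 0"
      proof
        fix k assume k: "k \<in> {- int n..int n} - int ` {..<Suc n}"
        have "k < 0"
        proof (rule ccontr)
          assume "\<not> k < 0"
          then have "k = int (nat k)" "nat k < Suc n" using k by auto
          then show False using k by blast
        qed
        then show "fourier_coeff f k * z powi k = 0"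
          using assms by (simp add: H2_def)
      qed
    qed auto
    then show ?thesis
      by (simp only: sum.reindex[OF inj_on_of_nat] o_def circle_inner_hardy_basis)
        (simp add: hardy_basis_def)
  qed
  then show ?thesis
    using fourier_series_tendsto[OF H2_imp_L2[OF assms]] by simp
qed

lemma H2_circle_eqI:
  assumes "f \<in> H2" "g \<in> H2" "\<And>n. circle_inner f (hardy_basis n) = circle_inner g (hardy_basis n)"
  shows "circle_eq f g"
proof (rule fourier_coeff_eq_imp_circle_eq)
  show "fourier_coeff f n = fourier_coeff g n" for n
  proof (cases "n < 0")
    case False
    then show ?thesis
      using assms(3)[of "nat n"] by (simp add: circle_inner_hardy_basis)
  qed (use assms in \<open>simp add: H2_def\<close>)
qed (use assms in \<open>auto intro: L2_imp_circle_integrable H2_imp_L2\<close>)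

lemma H2_Riesz_Fischer:
  assumes "(\<lambda>n. (norm (c n))\<^sup>2) summable_on UNIV"
  shows "\<exists>g\<in>H2. \<forall>n. circle_inner g (hardy_basis n) = c n"
proof -
  define d where "d = (\<lambda>k. if k < 0 then 0 else c (nat k))"
  obtain S where "((\<lambda>n. (norm (c n))\<^sup>2) has_sum S) UNIV"
    using assms by (auto simp: summable_on_def)
  then have "((\<lambda>k. (norm (d k))\<^sup>2) has_sum S) UNIV"
    by (subst has_sum_nonneg_int) (simp_all add: d_def)
  then obtain g where "g \<in> L2" "\<And>k. fourier_coeff g k = d k"
    using Riesz_Fischer[of d] by (metis has_sum_imp_summable)
  then show ?thesis
    by (intro bexI[of _ g]) (auto simp: H2_def circle_inner_hardy_basis d_def)
qed

lemma orthonormal_basis_hardy_basis: "orthonormal_basis hardy_basis"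
  unfolding orthonormal_basis_def
  by (auto simp: H2_hardy_basis circle_inner_hardy_basis_hardy_basis circle_inner_zero_left
      intro!: H2_circle_eqI H2_zero)

text \<open>Products carry no conjugate because a matrix row acts on coefficients in this form. The
  squared estimate can be summed over the rows directly.\<close>

lemma sums_Cauchy_Schwarz:
  fixes x y :: "nat \<Rightarrow> complex"
  assumes X: "((\<lambda>j. (norm (x j))\<^sup>2) has_sum X) UNIV" and Y: "((\<lambda>j. (norm (y j))\<^sup>2) has_sum Y) UNIV"
  shows "summable (\<lambda>j. x j * y j)"
    and "(\<lambda>j. x j * y j) sums s \<Longrightarrow> (norm s)\<^sup>2 \<le> X * Y"
proof -
  show "summable (\<lambda>j. x j * y j)"
  proof (rule summable_comparison_test')
    show "summable (\<lambda>j. (norm (x j))\<^sup>2 + (norm (y j))\<^sup>2)"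
      using has_sum_imp_sums[OF X] has_sum_imp_sums[OF Y] by (intro summable_add) (auto simp: sums_iff)
    fix j
    have "norm (x j) * norm (y j) \<ge> 0" by simp
    then show "norm (x j * y j) \<le> (norm (x j))\<^sup>2 + (norm (y j))\<^sup>2"
      using sum_squares_bound[of "norm (x j)" "norm (y j)"] unfolding norm_mult by linarith
  qed
  assume s: "(\<lambda>j. x j * y j) sums s"
  have "(norm (\<Sum>j<n. x j * y j))\<^sup>2 \<le> X * Y" for n
  proof -
    have "(norm (\<Sum>j<n. x j * y j))\<^sup>2 \<le> (\<Sum>j<n. norm (x j) * norm (y j))\<^sup>2"
      by (intro power_mono order_trans[OF norm_sum]) (simp_all add: norm_mult)
    also have "\<dots> \<le> (\<Sum>j<n. (norm (x j))\<^sup>2) * (\<Sum>j<n. (norm (y j))\<^sup>2)"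
      by (rule Cauchy_Schwarz_ineq_sum)
    also have "\<dots> \<le> X * Y"
      using has_sum_imp_sums[OF X] has_sum_imp_sums[OF Y] has_sum_nonneg[OF X]
      by (intro mult_mono) (auto simp: sums_iff intro!: sum_le_suminf sum_nonneg)
    finally show ?thesis .
  qed
  then show "(norm s)\<^sup>2 \<le> X * Y"
    by (intro LIMSEQ_le_const2[OF tendsto_power[OF tendsto_norm[OF s[unfolded sums_def]]]]) auto
qed

subsection \<open>Bounded operators and their matrices\<close>

lemma bounded_operator_H2: "bounded_operator T \<Longrightarrow> f \<in> H2 \<Longrightarrow> T f \<in> H2"
  by (simp add: bounded_operator_def)

lemma bounded_operator_L2: "bounded_operator T \<Longrightarrow> f \<in> H2 \<Longrightarrow> T f \<in> L2"
  by (simp add: bounded_operator_H2 H2_imp_L2)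

lemma bounded_operator_bound:
  assumes "bounded_operator T"
  obtains C where "C \<ge> 0" "\<And>f. f \<in> H2 \<Longrightarrow> L2_norm (T f) \<le> C * L2_norm f"
proof -
  obtain C where C: "\<And>f. f \<in> H2 \<Longrightarrow> L2_norm (T f) \<le> C * L2_norm f"
    using assms unfolding bounded_operator_def by blast
  show thesis
  proof (rule that)
    show "L2_norm (T f) \<le> \<bar>C\<bar> * L2_norm f" if "f \<in> H2" for f
      using C[OF that] mult_right_mono[OF abs_ge_self[of C] L2_norm_nonneg[of f]] by linarith
  qed simp
qed

text \<open>\<open>T\<close> is additive only up to null sets, an ambiguity that an inner product
  does not see. Linearity of \<open>T\<close> is used in this weak form from here on.\<close>

lemma circle_inner_bounded_operator_add:
  assumes "bounded_operator T" "f \<in> H2" "g \<in> H2" "h \<in> L2"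
  shows "circle_inner (T (\<lambda>z. f z + g z)) h = circle_inner (T f) h + circle_inner (T g) h"
proof -
  have "circle_inner (T (\<lambda>z. f z + g z)) h = circle_inner (\<lambda>z. T f z + T g z) h"
    using assms bounded_operator_L2[OF assms(1)] L2_add H2_add
    by (intro circle_inner_cong) (auto simp: bounded_operator_def L2_def)
  then show ?thesis
    using assms by (simp add: circle_inner_add_left bounded_operator_L2)
qed

lemma circle_inner_bounded_operator_scale:
  assumes "bounded_operator T" "f \<in> H2" "h \<in> L2"
  shows "circle_inner (T (\<lambda>z. c * f z)) h = c * circle_inner (T f) h"
proof -
  have "circle_inner (T (\<lambda>z. c * f z)) h = circle_inner (\<lambda>z. c * T f z) h"
    using assms bounded_operator_L2[OF assms(1)] L2_scale H2_scale
    by (intro circle_inner_cong) (auto simp: bounded_operator_def L2_def)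
  then show ?thesis
    by (simp add: circle_inner_scale_left)
qed

lemma circle_inner_bounded_operator_sum:
  assumes "bounded_operator T" "\<And>i. i \<in> F \<Longrightarrow> f i \<in> H2" "h \<in> L2"
  shows "circle_inner (T (\<lambda>z. \<Sum>i\<in>F. c i * f i z)) h = (\<Sum>i\<in>F. c i * circle_inner (T (f i)) h)"
proof -
  have zero: "circle_inner (T (\<lambda>z. 0)) h = 0"
    using circle_inner_bounded_operator_scale[OF assms(1) H2_zero assms(3), of 0] by simp
  show ?thesis
    using assms(2)
  proof (induction F rule: infinite_finite_induct)
    case (insert x F)
    have "circle_inner (T (\<lambda>z. c x * f x z + (\<Sum>i\<in>F. c i * f i z))) h =
        circle_inner (T (\<lambda>z. c x * f x z)) h + circle_inner (T (\<lambda>z. \<Sum>i\<in>F. c i * f i z)) h"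
      using insert.prems by (intro circle_inner_bounded_operator_add H2_scale H2_sum assms(1,3)) auto
    with insert show ?case
      by (simp add: circle_inner_bounded_operator_scale[OF assms(1) _ assms(3)])
  qed (simp_all add: zero)
qed

text \<open>Continuity of \<open>T\<close> carries the basis expansion of \<open>f\<close> through
  the operator. With \<open>h\<close> a basis vector this says that \<open>T\<close> acts by its
  matrix.\<close>

lemma circle_inner_bounded_operator_sums:
  assumes T: "bounded_operator T" and f: "f \<in> H2" and h: "h \<in> L2"
  shows "(\<lambda>j. circle_inner (T (hardy_basis j)) h * circle_inner f (hardy_basis j)) sums circle_inner (T f) h"
proof -
  obtain C where C: "C \<ge> 0" "\<And>f. f \<in> H2 \<Longrightarrow> L2_norm (T f) \<le> C * L2_norm f"
    using bounded_operator_bound[OF T] by blast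
  define P where "P = (\<lambda>n z. \<Sum>j<n. circle_inner f (hardy_basis j) * hardy_basis j z)"
  have P: "P n \<in> H2" for n
    unfolding P_def by (intro H2_sum H2_hardy_basis)
  have "(\<lambda>n. circle_inner (T (P (Suc n))) h - circle_inner (T f) h) \<longlonglongrightarrow> 0"
  proof (rule Lim_null_comparison, intro always_eventually allI)
    fix n
    \<comment> \<open>Splitting \<open>f\<close> into partial sum and remainder leaves
      \<open>T\<close> of the remainder, which the norm bound makes small.\<close>
    have "circle_inner (T (P (Suc n))) h + circle_inner (T (\<lambda>z. f z - P (Suc n) z)) h
        = circle_inner (T (\<lambda>z. P (Suc n) z + (f z - P (Suc n) z))) h"
      by (rule circle_inner_bounded_operator_add[symmetric]) (intro T P H2_diff f h)+
    then have "circle_inner (T (P (Suc n))) h - circle_inner (T f) h =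
        - circle_inner (T (\<lambda>z. f z - P (Suc n) z)) h"
      by (simp add: algebra_simps)
    then have "norm (circle_inner (T (P (Suc n))) h - circle_inner (T f) h)
        \<le> L2_norm (T (\<lambda>z. f z - P (Suc n) z)) * L2_norm h"
      using circle_inner_Cauchy_Schwarz[OF bounded_operator_L2[OF T H2_diff[OF f P]] h] by simp
    also have "\<dots> \<le> C * L2_norm (\<lambda>z. f z - P (Suc n) z) * L2_norm h"
      by (intro mult_right_mono C H2_diff f P L2_norm_nonneg)
    finally show "norm (circle_inner (T (P (Suc n))) h - circle_inner (T f) h)
        \<le> C * L2_norm (\<lambda>z. f z - P (Suc n) z) * L2_norm h" .
  next
    show "(\<lambda>n. C * L2_norm (\<lambda>z. f z - P (Suc n) z) * L2_norm h) \<longlonglongrightarrow> 0"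
      by (intro tendsto_mult_left_zero tendsto_mult_right_zero)
        (use H2_series_tendsto[OF f] in \<open>simp only: P_def\<close>)
  qed
  then have "(\<lambda>n. circle_inner (T (P (Suc n))) h) \<longlonglongrightarrow> circle_inner (T f) h"
    by (simp add: LIM_zero_iff)
  then have "(\<lambda>n. circle_inner (T (P n)) h) \<longlonglongrightarrow> circle_inner (T f) h"
    by (rule LIMSEQ_imp_Suc)
  then show ?thesis
    unfolding sums_def P_def circle_inner_bounded_operator_sum[OF T H2_hardy_basis h]
    by (simp add: mult.commute)
qed

text \<open>The sum is the squared norm of the adjoint of \<open>T\<close> at \<open>h\<close>.\<close>

lemma bounded_operator_row_summable:
  assumes T: "bounded_operator T" and h: "h \<in> L2"
  shows "(\<lambda>j. (norm (circle_inner (T (hardy_basis j)) h))\<^sup>2) summable_on UNIV"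
proof -
  obtain C where C: "C \<ge> 0" "\<And>f. f \<in> H2 \<Longrightarrow> L2_norm (T f) \<le> C * L2_norm f"
    using bounded_operator_bound[OF T] by blast
  have "(\<Sum>j\<in>F. (norm (circle_inner (T (hardy_basis j)) h))\<^sup>2) \<le> (C * L2_norm h)\<^sup>2" if "finite F" for F
  proof -
    define a where "a = (\<lambda>j. circle_inner (T (hardy_basis j)) h)"
    define s where "s = (\<Sum>j\<in>F. (norm (a j))\<^sup>2)"
    \<comment> \<open>Conjugate entries as coefficients make the pairing of \<open>T f\<close> with
      \<open>h\<close> equal to \<open>s\<close>, while \<open>f\<close> has norm
      \<open>sqrt s\<close>. Thus \<open>s \<le> C * sqrt s * L2_norm h\<close>, and one factor
      \<open>sqrt s\<close> cancels.\<close>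
    define f where "f = (\<lambda>z. \<Sum>j\<in>F. cnj (a j) * hardy_basis j z)"
    have "s \<ge> 0" by (simp add: s_def sum_nonneg)
    have f: "f \<in> H2"
      unfolding f_def by (intro H2_sum H2_hardy_basis)
    have s: "complex_of_real s = (\<Sum>j\<in>F. cnj (a j) * a j)"
      unfolding s_def of_real_sum complex_norm_square by (simp add: mult.commute)
    have Tf: "circle_inner (T f) h = of_real s"
      unfolding f_def s circle_inner_bounded_operator_sum[OF T H2_hardy_basis h] a_def ..
    have fj: "circle_inner f (hardy_basis j) = (if j \<in> F then cnj (a j) else 0)" for j
      unfolding f_def using that
      by (subst circle_inner_sum_left)
        (simp_all add: L2_hardy_basis circle_inner_hardy_basis_hardy_basis if_distrib cong: if_cong)
    have "circle_inner f f = of_real s"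
      unfolding s by (subst (2) f_def, subst circle_inner_sum_right)
        (auto simp: L2_hardy_basis H2_imp_L2 f fj intro!: sum.cong)
    then have norm_f: "L2_norm f = sqrt s"
      by (simp add: L2_norm_def)
    have "s \<le> L2_norm (T f) * L2_norm h"
      using circle_inner_Cauchy_Schwarz[OF bounded_operator_L2[OF T f] h] \<open>s \<ge> 0\<close> by (simp add: Tf)
    also have "\<dots> \<le> C * sqrt s * L2_norm h"
      using C(2)[OF f] by (intro mult_right_mono) (simp_all add: norm_f L2_norm_nonneg)
    finally have "sqrt s * sqrt s \<le> (C * L2_norm h) * sqrt s"
      using \<open>s \<ge> 0\<close> by (simp add: mult_ac)
    then have "sqrt s \<le> C * L2_norm h"
      using mult_right_le_imp_le[of "sqrt s" "sqrt s" "C * L2_norm h"]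
        \<open>s \<ge> 0\<close> \<open>C \<ge> 0\<close> L2_norm_nonneg[of h]
      by (cases "s = 0") (simp_all del: real_sqrt_mult_self)
    then have "(sqrt s)\<^sup>2 \<le> (C * L2_norm h)\<^sup>2"
      using \<open>s \<ge> 0\<close> by (intro power_mono) auto
    then show ?thesis
      using \<open>s \<ge> 0\<close> by (simp add: s_def a_def)
  qed
  then show ?thesis
    by (intro nonneg_bdd_above_summable_on) (auto intro!: bdd_aboveI2[where M = "(C * L2_norm h)\<^sup>2"])
qed

section \<open>Square summable matrices and Hilbert-Schmidt operators\<close>

text \<open>Cauchy-Schwarz in each row, then summation over the rows by Parseval for
  \<open>g\<close>. Speaking of a pair \<open>f\<close>, \<open>g\<close> instead of an operator
  makes it usable both for a given operator and for one whose boundedness is still to be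
  shown.\<close>

lemma hilbert_schmidt_matrix_norm_le:
  assumes M: "((\<lambda>(i, j). (norm (M i j))\<^sup>2) has_sum B) UNIV"
    and f: "f \<in> H2" and g: "g \<in> H2"
    and Mf: "\<And>i. (\<lambda>j. M i j * circle_inner f (hardy_basis j)) sums circle_inner g (hardy_basis i)"
  shows "(L2_norm g)\<^sup>2 \<le> B * (L2_norm f)\<^sup>2"
proof -
  have M': "((\<lambda>(i, j). (norm (M i j))\<^sup>2) has_sum B) (Sigma UNIV (\<lambda>_. UNIV))"
    using M by simp
  define R where "R = (\<lambda>i. \<Sum>\<^sub>\<infinity>j. (norm (M i j))\<^sup>2)"
  have row: "((\<lambda>j. (norm (M i j))\<^sup>2) has_sum R i) UNIV" for i
    using summable_on_SigmaD1[OF has_sum_imp_summable[OF M']] by (simp add: R_def)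
  have "(R has_sum B) UNIV"
    using has_sum_SigmaD[OF M', of R] row by simp
  then have "((\<lambda>i. R i * (L2_norm f)\<^sup>2) has_sum B * (L2_norm f)\<^sup>2) UNIV"
    by (rule has_sum_cmult_left)
  with H2_Parseval[OF g] show ?thesis
    by (rule has_sum_mono) (rule sums_Cauchy_Schwarz(2)[OF row H2_Parseval[OF f] Mf])
qed

lemma hilbert_schmidt_if_matrix_square_summable:
  assumes T: "bounded_operator T"
    and M: "((\<lambda>(i, j). (norm (circle_inner (T (hardy_basis j)) (hardy_basis i)))\<^sup>2) has_sum B) UNIV"
  shows "hilbert_schmidt T"
proof -
  note M
  \<comment> \<open>Summation is switched from rows to columns: by Parseval column \<open>j\<close>
    contributes the squared norm of the image of the \<open>j\<close>-th basis vector.\<close>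
  also have "((\<lambda>(i, j). (norm (circle_inner (T (hardy_basis j)) (hardy_basis i)))\<^sup>2) has_sum B) UNIV \<longleftrightarrow>
      ((\<lambda>(j, i). (norm (circle_inner (T (hardy_basis j)) (hardy_basis i)))\<^sup>2) has_sum B) (Sigma UNIV (\<lambda>_. UNIV))"
    by (rule has_sum_reindex_bij_witness[where i = prod.swap and j = prod.swap]) auto
  finally have "((\<lambda>j. (L2_norm (T (hardy_basis j)))\<^sup>2) has_sum B) UNIV"
    by (rule has_sum_SigmaD) (simp add: H2_Parseval bounded_operator_H2[OF T] H2_hardy_basis)
  then have "summable (\<lambda>j. (L2_norm (T (hardy_basis j)))\<^sup>2)"
    using has_sum_imp_sums sums_summable by blast
  with T show ?thesis
    unfolding hilbert_schmidt_def using orthonormal_basis_hardy_basis by blast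
qed

text \<open>The matrix sends the coefficients of \<open>f\<close> to a square summable sequence, and
  Riesz-Fischer realises that sequence in \<open>H2\<close>. Linearity and the norm bound are then
  read off from coefficients.\<close>

lemma bounded_operator_of_matrix:
  assumes M: "((\<lambda>(i, j). (norm (M i j))\<^sup>2) has_sum B) UNIV"
  shows "\<exists>T. bounded_operator T \<and> (\<forall>i j. circle_inner (T (hardy_basis j)) (hardy_basis i) = M i j)"
proof -
  have M': "((\<lambda>(i, j). (norm (M i j))\<^sup>2) has_sum B) (Sigma UNIV (\<lambda>_. UNIV))"
    using M by simp
  define R where "R = (\<lambda>i. \<Sum>\<^sub>\<infinity>j. (norm (M i j))\<^sup>2)"
  have row: "((\<lambda>j. (norm (M i j))\<^sup>2) has_sum R i) UNIV" for i
    using summable_on_SigmaD1[OF has_sum_imp_summable[OF M']] by (simp add: R_def)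
  have R: "(R has_sum B) UNIV"
    using has_sum_SigmaD[OF M', of R] row by simp
  have summable: "summable (\<lambda>j. M i j * circle_inner f (hardy_basis j))" if "f \<in> H2" for i f
    by (rule sums_Cauchy_Schwarz(1)[OF row H2_Parseval[OF that]])
  have ex: "\<exists>g\<in>H2. \<forall>i. circle_inner g (hardy_basis i) = (\<Sum>j. M i j * circle_inner f (hardy_basis j))"
    if f: "f \<in> H2" for f
  proof (rule H2_Riesz_Fischer)
    have "(\<lambda>i. R i * (L2_norm f)\<^sup>2) summable_on UNIV"
      using R by (intro summable_on_cmult_left has_sum_imp_summable)
    then show "(\<lambda>i. (norm (\<Sum>j. M i j * circle_inner f (hardy_basis j)))\<^sup>2) summable_on UNIV"
      by (rule summable_on_comparison_test)
        (auto intro: sums_Cauchy_Schwarz(2)[OF row H2_Parseval[OF f] summable_sums[OF summable[OF f]]])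
  qed
  \<comment> \<open>A representative is chosen for each \<open>f\<close> separately, with no
    coherence between the choices; this is why linearity comes out only modulo null sets.\<close>
  have "\<exists>T. \<forall>f\<in>H2. T f \<in> H2 \<and>
      (\<forall>i. circle_inner (T f) (hardy_basis i) = (\<Sum>j. M i j * circle_inner f (hardy_basis j)))"
    by (rule bchoice) (use ex in blast)
  then obtain T where T_H2: "T f \<in> H2"
    and T: "circle_inner (T f) (hardy_basis i) = (\<Sum>j. M i j * circle_inner f (hardy_basis j))"
    if "f \<in> H2" for f i
    by blast
  have T_add: "circle_eq (T (\<lambda>z. f z + g z)) (\<lambda>z. T f z + T g z)" if fg: "f \<in> H2" "g \<in> H2" for f g
  proof (rule H2_circle_eqI)
    fix i
    have "circle_inner (T (\<lambda>z. f z + g z)) (hardy_basis i) =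
       (\<Sum>j. M i j * circle_inner f (hardy_basis j) + M i j * circle_inner g (hardy_basis j))"
      using fg by (simp add: T H2_add circle_inner_add_left H2_imp_L2 L2_hardy_basis ring_distribs)
    also have "\<dots> = circle_inner (T f) (hardy_basis i) + circle_inner (T g) (hardy_basis i)"
      using fg by (simp add: T suminf_add summable)
    also have "\<dots> = circle_inner (\<lambda>z. T f z + T g z) (hardy_basis i)"
      using fg by (simp add: circle_inner_add_left T_H2 H2_imp_L2 L2_hardy_basis)
    finally show "circle_inner (T (\<lambda>z. f z + g z)) (hardy_basis i) =
      circle_inner (\<lambda>z. T f z + T g z) (hardy_basis i)" .
  qed (use fg in \<open>auto intro: T_H2 H2_add\<close>)
  have T_scale: "circle_eq (T (\<lambda>z. c * f z)) (\<lambda>z. c * T f z)" if f: "f \<in> H2" for c f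
  proof (rule H2_circle_eqI)
    fix i
    show "circle_inner (T (\<lambda>z. c * f z)) (hardy_basis i) = circle_inner (\<lambda>z. c * T f z) (hardy_basis i)"
      using suminf_mult[OF summable[OF f], of c i]
      by (simp add: T f H2_scale circle_inner_scale_left mult.left_commute)
  qed (use f in \<open>auto intro: T_H2 H2_scale\<close>)
  have T_bound: "L2_norm (T f) \<le> sqrt B * L2_norm f" if f: "f \<in> H2" for f
  proof -
    have "(L2_norm (T f))\<^sup>2 \<le> B * (L2_norm f)\<^sup>2"
      using M f T_H2[OF f]
      by (rule hilbert_schmidt_matrix_norm_le) (simp add: T f summable summable_sums)
    then show ?thesis
      using real_sqrt_le_mono[of "(L2_norm (T f))\<^sup>2" "B * (L2_norm f)\<^sup>2"]
      by (simp add: real_sqrt_mult L2_norm_nonneg)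
  qed
  have "bounded_operator T"
    unfolding bounded_operator_def
    by (intro conjI ballI allI exI[of _ "sqrt B"] T_H2 T_add T_scale T_bound)
  moreover have "circle_inner (T (hardy_basis j)) (hardy_basis i) = M i j" for i j
  proof -
    have "circle_inner (T (hardy_basis j)) (hardy_basis i) = (\<Sum>k. if k = j then M i k else 0)"
      unfolding T[OF H2_hardy_basis] circle_inner_hardy_basis_hardy_basis
      by (intro suminf_cong) auto
    also have "\<dots> = M i j"
      using sums_single[of j "M i"] by (simp add: sums_iff)
    finally show ?thesis .
  qed
  ultimately show ?thesis by blast
qed

subsection \<open>Toeplitz matrices\<close>

text \<open>Entries are grouped by diagonal: \<open>(i, j) \<leftrightarrow> (min i j, i - j)\<close> is a bijection onto
  \<open>\<nat> \<times> \<int>\<close>.\<close>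

lemma lambda_toeplitz_matrix_has_sum:
  fixes l :: complex and a :: "int \<Rightarrow> complex"
  assumes l: "norm l < 1" and a: "((\<lambda>n. (norm (a n))\<^sup>2) has_sum S) UNIV"
  shows "((\<lambda>(i, j). (norm (l ^ min i j * a (int i - int j)))\<^sup>2) has_sum S / (1 - (norm l)\<^sup>2)) UNIV"
proof -
  define q where "q = (norm l)\<^sup>2"
  have q: "0 \<le> q" "q < 1"
    using l by (auto simp: q_def abs_square_less_1)
  have "(\<lambda>k. q ^ k) sums (1 / (1 - q))"
    using q by (intro geometric_sums) simp
  then have "((\<lambda>k. q ^ k) has_sum (1 / (1 - q))) UNIV"
    using q by (intro sums_nonneg_imp_has_sum) auto
  then have outer: "((\<lambda>k. q ^ k * S) has_sum (1 / (1 - q) * S)) UNIV"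
    by (rule has_sum_cmult_left)
  have inner: "((\<lambda>n. q ^ k * (norm (a n))\<^sup>2) has_sum q ^ k * S) UNIV" for k
    using a by (rule has_sum_cmult_right)
  have "((\<lambda>(k, n). q ^ k * (norm (a n))\<^sup>2) has_sum (1 / (1 - q) * S)) (Sigma UNIV (\<lambda>_. UNIV))"
  proof (rule has_sum_SigmaI)
    show "(\<lambda>(k, n). q ^ k * (norm (a n))\<^sup>2) summable_on Sigma UNIV (\<lambda>_. UNIV)"
      using q by (intro summable_on_SigmaI[where g = "\<lambda>k. q ^ k * S"] has_sum_imp_summable[OF outer])
        (auto intro: inner)
  qed (use inner outer in auto)
  also have "?this \<longleftrightarrow> ?thesis"
    \<comment> \<open>Since \<open>nat\<close> cuts off at 0, at most one of \<open>nat n\<close>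
      and \<open>nat (- n)\<close> is nonzero: start on the border of the matrix at diagonal
      \<open>n\<close> and take \<open>k\<close> steps down it.\<close>
    by (rule has_sum_reindex_bij_witness[where j = "\<lambda>(k, n). (k + nat n, k + nat (- n))"
          and i = "\<lambda>(i, j). (min i j, int i - int j)"])
      (auto simp: q_def norm_mult norm_power power_mult_distrib min_def mult.commute
        nat_diff_distrib' split: if_splits simp flip: power_mult)
  finally show ?thesis .
qed

text \<open>Each step back along the diagonal costs one factor \<open>l\<close>, and the border is
  reached after \<open>min i j\<close> steps. The cut-off of \<open>nat\<close> names the border
  entry without a case distinction.\<close>

lemma matrix_diagonal_form:
  fixes M :: "nat \<Rightarrow> nat \<Rightarrow> 'a::comm_monoid_mult"
  assumes "\<And>i j. M (Suc i) (Suc j) = l * M i j"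
  shows "M i j = l ^ min i j * M (nat (int i - int j)) (nat (int j - int i))"
proof (induction i arbitrary: j)
  case 0
  then show ?case by simp
next
  case (Suc i)
  show ?case
  proof (cases j)
    case (Suc k)
    then show ?thesis
      using Suc.IH[of k] by (simp add: assms mult.assoc)
  qed (simp flip: Suc_nat_eq_nat_zadd1)
qed

lemma lambda_toeplitz_matrix:
  assumes "lambda_toeplitz l T"
  obtains a where "\<And>i j. circle_inner (T (hardy_basis j)) (hardy_basis i) = l ^ min i j * a (int i - int j)"
    and "(\<lambda>n. (norm (a n))\<^sup>2) summable_on UNIV"
proof
  \<comment> \<open>For \<open>n \<ge> 0\<close> this is the entry of column 0 in row
    \<open>n\<close>, for \<open>n \<le> 0\<close> that of row 0 in column
    \<open>- n\<close>.\<close>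
  define a where "a = (\<lambda>n. circle_inner (T (hardy_basis (nat (- n)))) (hardy_basis (nat n)))"
  have T: "bounded_operator T"
    using assms by (simp add: lambda_toeplitz_def)
  show "circle_inner (T (hardy_basis j)) (hardy_basis i) = l ^ min i j * a (int i - int j)" for i j
    using matrix_diagonal_form[of "\<lambda>i j. circle_inner (T (hardy_basis j)) (hardy_basis i)" l i j] assms
    by (simp add: lambda_toeplitz_def a_def)
  have "(\<lambda>n. (norm (a (int n)))\<^sup>2) summable_on UNIV"
    using H2_Parseval[OF bounded_operator_H2[OF T H2_hardy_basis[of 0]]]
    by (auto simp: a_def intro: has_sum_imp_summable)
  then have pos: "(\<lambda>n. (norm (a n))\<^sup>2) summable_on range int"
    by (subst summable_on_reindex) (auto simp: o_def inj_on_def)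
  have "(\<lambda>n. (norm (a (- int n)))\<^sup>2) summable_on UNIV"
    using bounded_operator_row_summable[OF T L2_hardy_basis[of 0]] by (simp add: a_def)
  then have neg: "(\<lambda>n. (norm (a n))\<^sup>2) summable_on range (\<lambda>n. - int n)"
    by (subst summable_on_reindex) (auto simp: o_def inj_on_def)
  \<comment> \<open>The two ranges share 0, which is harmless since only summability is claimed, not
    the value of the sum.\<close>
  have "x \<in> range int \<union> range (\<lambda>n. - int n)" for x
    by (cases x rule: int_cases2) auto
  then have "UNIV = range int \<union> range (\<lambda>n. - int n)"
    by blast
  then show "(\<lambda>n. (norm (a n))\<^sup>2) summable_on UNIV"
    using summable_on_union[OF pos neg] by simp
qed

section \<open>From the symbol to its operator and back\<close>

lemma represents_imp_lambda_toeplitz: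
  "represents l \<phi> T \<Longrightarrow> lambda_toeplitz l T"
  by (simp add: lambda_toeplitz_def represents_def mult.assoc)

lemma represents_imp_square_summable:
  assumes "represents l \<phi> T"
  shows "(\<lambda>n. (norm (fourier_coeff \<phi> n))\<^sup>2) summable_on UNIV"
proof -
  obtain a where a: "\<And>i j. circle_inner (T (hardy_basis j)) (hardy_basis i) = l ^ min i j * a (int i - int j)"
    "(\<lambda>n. (norm (a n))\<^sup>2) summable_on UNIV"
    using lambda_toeplitz_matrix[OF represents_imp_lambda_toeplitz[OF assms]] by blast
  \<comment> \<open>Coefficients are compared on the border, where the factor is
    \<open>l ^ 0 = 1\<close> even for \<open>l = 0\<close>.\<close>
  have "min (nat n) (nat (- n)) = 0" "int (nat n) - int (nat (- n)) = n" for n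
    by auto
  then have "fourier_coeff \<phi> n = a n" for n
    using a(1)[of "nat (- n)" "nat n"] assms by (simp add: represents_def)
  with a(2) show ?thesis by simp
qed

theorem proposition2p2:
  fixes l :: complex and \<phi> :: "complex \<Rightarrow> complex"
  assumes "norm l < 1" and "circle_measurable \<phi>"
  shows "(toeplitz_bounded l \<phi> \<longleftrightarrow> \<phi> \<in> L2) \<and>
    (\<forall>T. lambda_toeplitz l T \<longrightarrow> hilbert_schmidt T) \<and>
    (\<forall>T. represents l \<phi> T \<longrightarrow>
       (\<lambda>n. (norm (fourier_coeff \<phi> n))\<^sup>2) summable_on UNIV \<and>
       operator_norm T \<le> (1 - (norm l)\<^sup>2) powr (- 1 / 2) *
         (\<Sum>\<^sub>\<infinity>n. (norm (fourier_coeff \<phi> n))\<^sup>2) powr (1 / 2))"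
proof (intro conjI allI impI)
  show "(\<lambda>n. (norm (fourier_coeff \<phi> n))\<^sup>2) summable_on UNIV" if "represents l \<phi> T" for T
    using that by (rule represents_imp_square_summable)
  show "toeplitz_bounded l \<phi> \<longleftrightarrow> \<phi> \<in> L2"
  proof
    assume "toeplitz_bounded l \<phi>"
    then obtain T where T: "represents l \<phi> T"
      by (auto simp: toeplitz_bounded_def)
    then have "circle_integrable \<phi>"
      by (simp add: represents_def)
    then show "\<phi> \<in> L2"
      using represents_imp_square_summable[OF T] assms(2) by (simp add: L2_iff_fourier_coeff_square_summable)
  next
    assume L2: "\<phi> \<in> L2"
    then show "toeplitz_bounded l \<phi>"
      using bounded_operator_of_matrix[OF lambda_toeplitz_matrix_has_sum[OF assms(1) Parseval_identity[OF L2]]]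
      by (auto simp: toeplitz_bounded_def represents_def L2_imp_circle_integrable)
  qed
  show "hilbert_schmidt T" if T: "lambda_toeplitz l T" for T
  proof -
    obtain a where a: "\<And>i j. circle_inner (T (hardy_basis j)) (hardy_basis i) = l ^ min i j * a (int i - int j)"
      "(\<lambda>n. (norm (a n))\<^sup>2) summable_on UNIV"
      using lambda_toeplitz_matrix[OF T] by blast
    have "bounded_operator T"
      using T by (simp add: lambda_toeplitz_def)
    then show ?thesis
      using lambda_toeplitz_matrix_has_sum[OF assms(1) has_sum_infsum[OF a(2)]]
      by (intro hilbert_schmidt_if_matrix_square_summable) (simp_all add: a(1))
  qed
  show "operator_norm T \<le> (1 - (norm l)\<^sup>2) powr (- 1 / 2) *
         (\<Sum>\<^sub>\<infinity>n. (norm (fourier_coeff \<phi> n))\<^sup>2) powr (1 / 2)" if T: "represents l \<phi> T" for T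
  proof -
    define S where "S = (\<Sum>\<^sub>\<infinity>n. (norm (fourier_coeff \<phi> n))\<^sup>2)"
    have "S \<ge> 0" by (simp add: S_def infsum_nonneg)
    have l: "(norm l)\<^sup>2 < 1"
      using assms(1) by (simp add: abs_square_less_1)
    have bT: "bounded_operator T"
      using T by (simp add: represents_def)
    have "((\<lambda>(i, j). (norm (circle_inner (T (hardy_basis j)) (hardy_basis i)))\<^sup>2) has_sum S / (1 - (norm l)\<^sup>2)) UNIV"
      using lambda_toeplitz_matrix_has_sum[OF assms(1) has_sum_infsum[OF represents_imp_square_summable[OF T]]] T
      by (simp add: represents_def S_def)
    then have le: "(L2_norm (T f))\<^sup>2 \<le> S / (1 - (norm l)\<^sup>2) * (L2_norm f)\<^sup>2" if "f \<in> H2" for f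
      by (rule hilbert_schmidt_matrix_norm_le)
        (intro that bounded_operator_H2[OF bT] circle_inner_bounded_operator_sums[OF bT] L2_hardy_basis)+
    have "operator_norm T \<le> sqrt (S / (1 - (norm l)\<^sup>2))"
      unfolding operator_norm_def
    proof (rule cSUP_least)
      \<comment> \<open>The supremum is over reals, so the unit ball must be shown to be nonempty
        before the pointwise bound passes to it.\<close>
      have "(\<lambda>z. 0) \<in> {f \<in> H2. L2_norm f \<le> 1}"
        by (simp add: H2_zero L2_norm_def circle_inner_zero_left)
      then show "{f \<in> H2. L2_norm f \<le> 1} \<noteq> {}" by blast
      fix f assume f: "f \<in> {f \<in> H2. L2_norm f \<le> 1}"
      have "(L2_norm (T f))\<^sup>2 \<le> S / (1 - (norm l)\<^sup>2) * (L2_norm f)\<^sup>2"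
        using f by (intro le) simp
      also have "\<dots> \<le> S / (1 - (norm l)\<^sup>2) * 1"
        using f l \<open>S \<ge> 0\<close> L2_norm_nonneg[of f]
        by (intro mult_left_mono divide_nonneg_nonneg) (auto simp: power_le_one)
      finally show "L2_norm (T f) \<le> sqrt (S / (1 - (norm l)\<^sup>2))"
        by (simp add: real_le_rsqrt)
    qed
    also have "\<dots> = (1 - (norm l)\<^sup>2) powr (- 1 / 2) * S powr (1 / 2)"
      using l \<open>S \<ge> 0\<close> by (simp add: powr_half_sqrt powr_minus real_sqrt_divide field_simps)
    finally show ?thesis by (simp add: S_def)
  qed
qed

end
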